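(* The cut rule is admissible for the sequent system $\mathcal S$: for every (ground, normal-form) sequent $\Gamma \vdash M$ that is derivable in $\mathcal S$, there is a derivation of $\Gamma \vdash M$ in $\mathcal S$ containing no instance of the rule $cut$.
   Context: Messages: fix countably infinite sets of names and variables, the constructors $\mathsf{pub}$ (unary), $\mathsf{sign}$, $\mathsf{blind}$, pairing $\langle\cdot,\cdot\rangle$ and symmetric encryption $\{\cdot\}_\cdot$ (binary), and a finite signature $\Sigma_E$ of function symbols disjoint from the constructors. Messages are $M,N ::= a \mid x \mid \mathsf{pub}(M) \mid \mathsf{sign}(M,N) \mid \mathsf{blind}(M,N) \mid \langle M,N\rangle \mid \{M\}_N \mid f(M_1,\ldots,M_k)$ with $a$ a name, $x$ a variable, $f\in\Sigma_E$. All messages are ground (variable-free). $E$ is an equational theory over $\Sigma_E$ containing at most one associative-commutative (AC) binary symbol $\oplus$, presented by a rewrite system $R_E$ (each right-hand-side variable occurs in the left-hand side) that is terminating and confluent modulo AC of $\oplus$. $\equiv$ is equality modulo AC of $\oplus$, $\approx_E$ is equality modulo $E$, and $\downarrow M$ is the $R_E$-normal form of $M$ modulo AC (extended to sets elementwise). A term $f(M_1,\ldots,M_k)$ is headed by $f$ and has immediate subterms $M_1,\ldots,M_k$. A term is $E$-alien if it is headed by a symbol (constructor or function symbol) not in $\Sigma_E$. An $E$-alien subterm $A$ of $N$ is an $E$-factor of $N$ if $A$ is an immediate subterm of some subterm of $N$ headed by a symbol of $\Sigma_E$; $A$ is an $E$-factor of a set if it is an $E$-factor of one of its members. An $E$-context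 is a term built from holes using only function symbols of $\Sigma_E$; $C[M_1,\ldots,M_k]$ is the result of filling its holes (in order) with $M_1,\ldots,M_k$. A sequent $\Gamma\vdash M$ has $\Gamma$ a finite set of messages; $\Gamma, M$ means $\Gamma\cup\{M\}$; all terms in sequents are in $E$-normal form. System $\mathcal S$ has the rules (premises $\Rightarrow$ conclusion): (id) $\Gamma\vdash M$ if $M\approx_E C[M_1,\ldots,M_k]$ for some $E$-context $C$ and $M_1,\ldots,M_k\in\Gamma$; (cut) $\Gamma\vdash M$ and $\Gamma,M\vdash T$ $\Rightarrow$ $\Gamma\vdash T$; ($p_L$) $\Gamma,\langle M,N\rangle,M,N\vdash T \Rightarrow \Gamma,\langle M,N\rangle\vdash T$; ($p_R$) $\Gamma\vdash M$, $\Gamma\vdash N\Rightarrow\Gamma\vdash\langle M,N\rangle$; ($e_L$) $\Gamma,\{M\}_K\vdash K$ and $\Gamma,\{M\}_K,M,K\vdash N \Rightarrow \Gamma,\{M\}_K\vdash N$; ($e_R$) $\Gamma\vdash M$, $\Gamma\vdash K\Rightarrow \Gamma\vdash\{M\}_K$; ($\mathsf{sign}_L$) $\Gamma,\mathsf{sign}(M,K),\mathsf{pub}(L),M\vdash N\Rightarrow\Gamma,\mathsf{sign}(M,K),\mathsf{pub}(L)\vdash N$, provided $K\equiv L$; ($\mathsf{sign}_R$) $\Gamma\vdash M$, $\Gamma\vdash K\Rightarrow\Gamma\vdash\mathsf{sign}(M,K)$; ($\mathsf{blind}_{L1}$) $\Gamma,\mathsf{blind}(M,K)\vdash K$ and $\Gamma,\mathsf{blind}(M,K),M,K\vdash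 N\Rightarrow\Gamma,\mathsf{blind}(M,K)\vdash N$; ($\mathsf{blind}_R$) $\Gamma\vdash M$, $\Gamma\vdash K\Rightarrow\Gamma\vdash\mathsf{blind}(M,K)$; ($\mathsf{blind}_{L2}$) $\Gamma,\mathsf{sign}(\mathsf{blind}(M,R),K)\vdash R$ and $\Gamma,\mathsf{sign}(\mathsf{blind}(M,R),K),\mathsf{sign}(M,K),R\vdash N\Rightarrow\Gamma,\mathsf{sign}(\mathsf{blind}(M,R),K)\vdash N$; (acut) $\Gamma\vdash A$ and $\Gamma,A\vdash M\Rightarrow\Gamma\vdash M$, where $A$ is an $E$-factor of $\Gamma\cup\{M\}$. *)

theory Defs
  imports Main
begin

section \<open>Messages\<close>

text \<open>
  The type \<open>'f\<close> provides the raw function symbols; which of them belong to the signature, and with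
  which arity, is fixed by the component \<open>sig\<close> of an \<open>'f eq_theory\<close> below.
\<close>

datatype 'f msg =
    Name nat
  | Var nat
  | Pub "'f msg"
  | Sign "'f msg" "'f msg"
  | Blind "'f msg" "'f msg"
  | MPair "'f msg" "'f msg"
  | Enc "'f msg" "'f msg"  \<comment> \<open>plaintext, then key\<close>
  | Fun 'f "'f msg list"

fun vars :: "'f msg \<Rightarrow> nat set" where
  "vars (Name a) = {}"
| "vars (Var x) = {x}"
| "vars (Pub M) = vars M"
| "vars (Sign M N) = vars M \<union> vars N"
| "vars (Blind M N) = vars M \<union> vars N"
| "vars (MPair M N) = vars M \<union> vars N"
| "vars (Enc M N) = vars M \<union> vars N"
| "vars (Fun f Ms) = (\<Union>M\<in>set Ms. vars M)"

definition ground :: "'f msg \<Rightarrow> bool" where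
  "ground M \<longleftrightarrow> vars M = {}"

fun subst :: "(nat \<Rightarrow> 'f msg) \<Rightarrow> 'f msg \<Rightarrow> 'f msg" where
  "subst \<sigma> (Name a) = Name a"
| "subst \<sigma> (Var x) = \<sigma> x"
| "subst \<sigma> (Pub M) = Pub (subst \<sigma> M)"
| "subst \<sigma> (Sign M N) = Sign (subst \<sigma> M) (subst \<sigma> N)"
| "subst \<sigma> (Blind M N) = Blind (subst \<sigma> M) (subst \<sigma> N)"
| "subst \<sigma> (MPair M N) = MPair (subst \<sigma> M) (subst \<sigma> N)"
| "subst \<sigma> (Enc M N) = Enc (subst \<sigma> M) (subst \<sigma> N)"
| "subst \<sigma> (Fun f Ms) = Fun f (map (subst \<sigma>) Ms)"

fun immediate_subterms :: "'f msg \<Rightarrow> 'f msg set" where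
  "immediate_subterms (Name a) = {}"
| "immediate_subterms (Var x) = {}"
| "immediate_subterms (Pub M) = {M}"
| "immediate_subterms (Sign M N) = {M, N}"
| "immediate_subterms (Blind M N) = {M, N}"
| "immediate_subterms (MPair M N) = {M, N}"
| "immediate_subterms (Enc M N) = {M, N}"
| "immediate_subterms (Fun f Ms) = set Ms"

definition subterm :: "'f msg \<Rightarrow> 'f msg \<Rightarrow> bool" where
  "subterm = (\<lambda>M N. M \<in> immediate_subterms N)\<^sup>*\<^sup>*"

section \<open>Equational theories presented by AC-convergent rewrite systems\<close>

text \<open>
  \<open>sig E\<close> maps the symbols of the signature to their arities, \<open>ac E\<close> is the AC symbol, if there is
  one, and \<open>rules E\<close> is the rewrite system. The equational theory is generated by the rules
  together with associativity and commutativity of the AC symbol.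
\<close>

record 'f eq_theory =
  sig :: "'f \<rightharpoonup> nat"
  ac :: "'f option"
  rules :: "('f msg \<times> 'f msg) set"

fun message :: "'f eq_theory \<Rightarrow> 'f msg \<Rightarrow> bool" where
  "message E (Name a) \<longleftrightarrow> True"
| "message E (Var x) \<longleftrightarrow> True"
| "message E (Pub M) \<longleftrightarrow> message E M"
| "message E (Sign M N) \<longleftrightarrow> message E M \<and> message E N"
| "message E (Blind M N) \<longleftrightarrow> message E M \<and> message E N"
| "message E (MPair M N) \<longleftrightarrow> message E M \<and> message E N"
| "message E (Enc M N) \<longleftrightarrow> message E M \<and> message E N"
| "message E (Fun f Ms) \<longleftrightarrow> sig E f = Some (length Ms) \<and> (\<forall>M\<in>set Ms. message E M)"

text \<open>The terms over the signature and variables only, as they occur in equations and rules.\<close>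

fun E_term :: "'f eq_theory \<Rightarrow> 'f msg \<Rightarrow> bool" where
  "E_term E (Var x) \<longleftrightarrow> True"
| "E_term E (Fun f Ms) \<longleftrightarrow> sig E f = Some (length Ms) \<and> (\<forall>M\<in>set Ms. E_term E M)"
| "E_term E _ \<longleftrightarrow> False"

inductive rewrite :: "('f msg \<times> 'f msg) set \<Rightarrow> 'f msg \<Rightarrow> 'f msg \<Rightarrow> bool"
  for R :: "('f msg \<times> 'f msg) set"
where
  root: "(l, r) \<in> R \<Longrightarrow> rewrite R (subst \<sigma> l) (subst \<sigma> r)"
| pub: "rewrite R M M' \<Longrightarrow> rewrite R (Pub M) (Pub M')"
| sign1: "rewrite R M M' \<Longrightarrow> rewrite R (Sign M N) (Sign M' N)"
| sign2: "rewrite R N N' \<Longrightarrow> rewrite R (Sign M N) (Sign M N')"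
| blind1: "rewrite R M M' \<Longrightarrow> rewrite R (Blind M N) (Blind M' N)"
| blind2: "rewrite R N N' \<Longrightarrow> rewrite R (Blind M N) (Blind M N')"
| pair1: "rewrite R M M' \<Longrightarrow> rewrite R (MPair M N) (MPair M' N)"
| pair2: "rewrite R N N' \<Longrightarrow> rewrite R (MPair M N) (MPair M N')"
| enc1: "rewrite R M M' \<Longrightarrow> rewrite R (Enc M N) (Enc M' N)"
| enc2: "rewrite R N N' \<Longrightarrow> rewrite R (Enc M N) (Enc M N')"
| "fun": "rewrite R M M' \<Longrightarrow> rewrite R (Fun f (Ms @ M # Ns)) (Fun f (Ms @ M' # Ns))"

text \<open>Rewriting is relativised to messages, since \<open>'f msg\<close> also contains ill-formed terms.\<close>

definition step :: "'f eq_theory \<Rightarrow> ('f msg \<times> 'f msg) set \<Rightarrow> 'f msg \<Rightarrow> 'f msg \<Rightarrow> bool" where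
  "step E R M N \<longleftrightarrow> message E M \<and> message E N \<and> rewrite R M N"

definition ac_axioms :: "'f eq_theory \<Rightarrow> ('f msg \<times> 'f msg) set" where
  "ac_axioms E =
    (case ac E of
       None \<Rightarrow> {}
     | Some p \<Rightarrow>
         {(Fun p [Var 0, Var 1], Fun p [Var 1, Var 0]),
          (Fun p [Fun p [Var 0, Var 1], Var 2], Fun p [Var 0, Fun p [Var 1, Var 2]])})"

definition ac_eq :: "'f eq_theory \<Rightarrow> 'f msg \<Rightarrow> 'f msg \<Rightarrow> bool" where
  "ac_eq E = equivclp (step E (ac_axioms E))"

definition E_eq :: "'f eq_theory \<Rightarrow> 'f msg \<Rightarrow> 'f msg \<Rightarrow> bool" where
  "E_eq E = equivclp (step E (ac_axioms E \<union> rules E))"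

text \<open>Rewriting modulo AC is rewriting of AC-equivalence classes.\<close>

definition step_mod_ac :: "'f eq_theory \<Rightarrow> 'f msg \<Rightarrow> 'f msg \<Rightarrow> bool" where
  "step_mod_ac E = ac_eq E OO step E (rules E) OO ac_eq E"

definition normal :: "'f eq_theory \<Rightarrow> 'f msg \<Rightarrow> bool" where
  "normal E M \<longleftrightarrow> (\<nexists>N. step_mod_ac E M N)"

definition terminating_mod_ac :: "'f eq_theory \<Rightarrow> bool" where
  "terminating_mod_ac E \<longleftrightarrow> (\<nexists>f :: nat \<Rightarrow> 'f msg. \<forall>i. step_mod_ac E (f i) (f (Suc i)))"

definition confluent_mod_ac :: "'f eq_theory \<Rightarrow> bool" where
  "confluent_mod_ac E \<longleftrightarrow>
    (\<forall>M N N'. message E M \<and> (step_mod_ac E)\<^sup>*\<^sup>* M N \<and> (step_mod_ac E)\<^sup>*\<^sup>* M N' \<longrightarrow>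
      (\<exists>P P'. (step_mod_ac E)\<^sup>*\<^sup>* N P \<and> (step_mod_ac E)\<^sup>*\<^sup>* N' P' \<and> ac_eq E P P'))"

definition ac_convergent_theory :: "'f eq_theory \<Rightarrow> bool" where
  "ac_convergent_theory E \<longleftrightarrow>
    finite (dom (sig E)) \<and>
    (\<forall>p. ac E = Some p \<longrightarrow> sig E p = Some 2) \<and>
    (\<forall>(l, r)\<in>rules E. E_term E l \<and> E_term E r \<and> vars r \<subseteq> vars l) \<and>
    terminating_mod_ac E \<and>
    confluent_mod_ac E"

section \<open>Factors and contexts\<close>

fun sig_headed :: "'f eq_theory \<Rightarrow> 'f msg \<Rightarrow> bool" where
  "sig_headed E (Fun f Ms) \<longleftrightarrow> f \<in> dom (sig E)"
| "sig_headed E _ \<longleftrightarrow> False"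

text \<open>Names and variables are not headed by any symbol, hence not alien.\<close>

fun E_alien :: "'f eq_theory \<Rightarrow> 'f msg \<Rightarrow> bool" where
  "E_alien E (Name a) \<longleftrightarrow> False"
| "E_alien E (Var x) \<longleftrightarrow> False"
| "E_alien E (Fun f Ms) \<longleftrightarrow> f \<notin> dom (sig E)"
| "E_alien E _ \<longleftrightarrow> True"

definition E_factor :: "'f eq_theory \<Rightarrow> 'f msg \<Rightarrow> 'f msg \<Rightarrow> bool" where
  "E_factor E A N \<longleftrightarrow>
    E_alien E A \<and> subterm A N \<and>
    (\<exists>F. subterm F N \<and> sig_headed E F \<and> A \<in> immediate_subterms F)"

definition E_factor_of_set :: "'f eq_theory \<Rightarrow> 'f msg \<Rightarrow> 'f msg set \<Rightarrow> bool" where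
  "E_factor_of_set E A X \<longleftrightarrow> (\<exists>N\<in>X. E_factor E A N)"

datatype 'f ctxt = Hole | CFun 'f "'f ctxt list"

fun E_context :: "'f eq_theory \<Rightarrow> 'f ctxt \<Rightarrow> bool" where
  "E_context E Hole \<longleftrightarrow> True"
| "E_context E (CFun f Cs) \<longleftrightarrow> sig E f = Some (length Cs) \<and> (\<forall>C\<in>set Cs. E_context E C)"

fun holes :: "'f ctxt \<Rightarrow> nat" where
  "holes Hole = 1"
| "holes (CFun f Cs) = sum_list (map holes Cs)"

text \<open>\<open>fill C Ms\<close> is meant for \<open>length Ms = holes C\<close> and fills the holes from left to right.\<close>

fun fill :: "'f ctxt \<Rightarrow> 'f msg list \<Rightarrow> 'f msg"
  and fills :: "'f ctxt list \<Rightarrow> 'f msg list \<Rightarrow> 'f msg list"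
where
  "fill Hole Ms = hd Ms"
| "fill (CFun f Cs) Ms = Fun f (fills Cs Ms)"
| "fills [] Ms = []"
| "fills (C # Cs) Ms = fill C (take (holes C) Ms) # fills Cs (drop (holes C) Ms)"

section \<open>The sequent system\<close>

type_synonym 'f seqt = "'f msg set \<times> 'f msg"

definition sequent :: "'f eq_theory \<Rightarrow> 'f seqt \<Rightarrow> bool" where
  "sequent E = (\<lambda>(\<Gamma>, T).
    finite \<Gamma> \<and> (\<forall>M\<in>insert T \<Gamma>. message E M \<and> ground M \<and> normal E M))"

datatype rule_name =
  Id | Cut | PL | PR | EL | ER | SignL | SignR | BlindL1 | BlindL2 | BlindR | ACut

text \<open>\<open>rule_inst E \<rho> Ss S\<close>: from the premises \<open>Ss\<close> the rule \<open>\<rho>\<close> infers the conclusion \<open>S\<close>.\<close>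

inductive rule_inst :: "'f eq_theory \<Rightarrow> rule_name \<Rightarrow> 'f seqt list \<Rightarrow> 'f seqt \<Rightarrow> bool"
  for E :: "'f eq_theory"
where
  "E_context E C \<Longrightarrow> length Ms = holes C \<Longrightarrow> set Ms \<subseteq> \<Gamma> \<Longrightarrow> E_eq E M (fill C Ms) \<Longrightarrow>
    rule_inst E Id [] (\<Gamma>, M)"
| "rule_inst E Cut [(\<Gamma>, M), (insert M \<Gamma>, T)] (\<Gamma>, T)"
| "rule_inst E PL [({MPair M N, M, N} \<union> \<Gamma>, T)] ({MPair M N} \<union> \<Gamma>, T)"
| "rule_inst E PR [(\<Gamma>, M), (\<Gamma>, N)] (\<Gamma>, MPair M N)"
| "rule_inst E EL [({Enc M K} \<union> \<Gamma>, K), ({Enc M K, M, K} \<union> \<Gamma>, N)] ({Enc M K} \<union> \<Gamma>, N)"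
| "rule_inst E ER [(\<Gamma>, M), (\<Gamma>, K)] (\<Gamma>, Enc M K)"
| "ac_eq E K L \<Longrightarrow>
    rule_inst E SignL [({Sign M K, Pub L, M} \<union> \<Gamma>, N)] ({Sign M K, Pub L} \<union> \<Gamma>, N)"
| "rule_inst E SignR [(\<Gamma>, M), (\<Gamma>, K)] (\<Gamma>, Sign M K)"
| "rule_inst E BlindL1 [({Blind M K} \<union> \<Gamma>, K), ({Blind M K, M, K} \<union> \<Gamma>, N)] ({Blind M K} \<union> \<Gamma>, N)"
| "rule_inst E BlindR [(\<Gamma>, M), (\<Gamma>, K)] (\<Gamma>, Blind M K)"
| "rule_inst E BlindL2
    [({Sign (Blind M R) K} \<union> \<Gamma>, R), ({Sign (Blind M R) K, Sign M K, R} \<union> \<Gamma>, N)]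
    ({Sign (Blind M R) K} \<union> \<Gamma>, N)"
| "E_factor_of_set E A (\<Gamma> \<union> {M}) \<Longrightarrow>
    rule_inst E ACut [(\<Gamma>, A), (insert A \<Gamma>, M)] (\<Gamma>, M)"

text \<open>
  Derivations are finite trees of rule instances, recorded by the names of the rules applied. Every
  sequent in a derivation, not only its end sequent, consists of ground messages in normal form.
\<close>

datatype derivation = Infer rule_name "derivation list"

fun rules_used :: "derivation \<Rightarrow> rule_name set" where
  "rules_used (Infer \<rho> ds) = {\<rho>} \<union> (\<Union>d\<in>set ds. rules_used d)"

inductive derives :: "'f eq_theory \<Rightarrow> derivation \<Rightarrow> 'f seqt \<Rightarrow> bool"
  for E :: "'f eq_theory"
where
  "sequent E S \<Longrightarrow> rule_inst E \<rho> Ss S \<Longrightarrow> list_all2 (derives E) ds Ss \<Longrightarrow>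
    derives E (Infer \<rho> ds) S"
monos list_all2_mono

end

theory Submission
  imports Defs
begin

text \<open>
  Fix a sequent \<open>\<Gamma> \<turnstile> T\<close> and saturate \<open>\<Gamma>\<close> under the left rules and under \<open>acut\<close> for the factors of
  \<open>\<Gamma> \<union> {T}\<close>, admitting only side premises that follow by \<open>id\<close> and right rules. Such a saturation is
  a linear cut-free derivation, in which the goal \<open>T\<close> never changes. Let a message be known if it is
  generated from the saturated set by constructors and \<open>E\<close>-contexts. Two facts give the theorem.

  First, known messages are closed under all rules, cut included. The only critical case is
  decomposition: reduction to normal form creates no new alien subterms, so a known constructor
  message is, modulo AC, composed of known messages, a member of the saturated set, or a factor
  of a member; in the last case saturation under \<open>acut\<close> puts it into the saturated set.

  Secondly, if all factors of a known message are factors of \<open>\<Gamma> \<union> {T}\<close>, then it follows from the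
  saturated set by \<open>id\<close> and right rules alone: composed messages below a symbol of the signature are
  either factors of the message or of the saturated set, hence in the saturated set by \<open>acut\<close>, or
  they occur neither in the message nor in the saturated set and can be replaced by anything.
\<close>

section \<open>Rewriting modulo AC\<close>

text \<open>The congruence and stability results below are instances: \<open>g\<close> is the
  identity, a one-hole context or a replacement of leaves.\<close>

lemma equivclp_map:
  assumes "equivclp r x y" and "\<And>x y. r x y \<Longrightarrow> equivclp s (g x) (g y)"
  shows "equivclp s (g x) (g y)"
  using assms(1)
proof (induction rule: equivclp_induct)
  case (step y z)
  then show ?case
    using assms(2)[of y z] assms(2)[of z y] equivclp_trans[of s "g x" "g y" "g z"]
      equivclp_sym[of s "g z" "g y"] by blast
qed simp

lemma step_message: "step E R M N \<Longrightarrow> message E M \<and> message E N"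
  by (simp add: step_def)

lemma equivclp_step_message:
  "equivclp (step E R) M N \<Longrightarrow> message E M \<longleftrightarrow> message E N"
  by (induction rule: equivclp_induct) (auto dest: step_message)

lemma ac_eq_message: "ac_eq E M N \<Longrightarrow> message E M \<longleftrightarrow> message E N"
  unfolding ac_eq_def by (rule equivclp_step_message)

lemma E_eq_message: "E_eq E M N \<Longrightarrow> message E M \<longleftrightarrow> message E N"
  unfolding E_eq_def by (rule equivclp_step_message)

lemma ac_eq_refl [simp, intro]: "ac_eq E M M"
  by (simp add: ac_eq_def)

lemma E_eq_refl [simp, intro]: "E_eq E M M"
  by (simp add: E_eq_def)

lemma ac_eq_sym: "ac_eq E M N \<Longrightarrow> ac_eq E N M"
  unfolding ac_eq_def by (rule equivclp_sym)

lemma E_eq_sym: "E_eq E M N \<Longrightarrow> E_eq E N M"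
  unfolding E_eq_def by (rule equivclp_sym)

lemma ac_eq_trans: "ac_eq E M N \<Longrightarrow> ac_eq E N P \<Longrightarrow> ac_eq E M P"
  unfolding ac_eq_def by (rule equivclp_trans)

lemma E_eq_trans: "E_eq E M N \<Longrightarrow> E_eq E N P \<Longrightarrow> E_eq E M P"
  unfolding E_eq_def by (rule equivclp_trans)

lemma rewrite_mono: "rewrite R M N \<Longrightarrow> R \<subseteq> R' \<Longrightarrow> rewrite R' M N"
  by (induction rule: rewrite.induct) (auto intro: rewrite.intros)

lemma step_mono: "step E R M N \<Longrightarrow> R \<subseteq> R' \<Longrightarrow> step E R' M N"
  by (auto simp: step_def intro: rewrite_mono)

lemma ac_eq_imp_E_eq: "ac_eq E M N \<Longrightarrow> E_eq E M N"
  unfolding ac_eq_def E_eq_def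
  by (erule equivclp_map[where g = "\<lambda>x. x"]) (auto intro: r_into_equivclp step_mono)

lemma step_imp_E_eq: "step E (ac_axioms E \<union> rules E) M N \<Longrightarrow> E_eq E M N"
  unfolding E_eq_def by (rule r_into_equivclp)

lemma step_rules_imp_E_eq: "step E (rules E) M N \<Longrightarrow> E_eq E M N"
  by (auto intro: step_imp_E_eq step_mono)

lemma ac_eq_step_mod_ac: "ac_eq E M N \<Longrightarrow> step_mod_ac E N P \<Longrightarrow> step_mod_ac E M P"
  unfolding step_mod_ac_def by (blast intro: ac_eq_trans)

text \<open>\<open>E_eq\<close> mixes AC steps with rule steps, whereas confluence is stated for
  rules modulo AC. This induction separates the two and keeps \<open>E_eq E M X\<close> at hand, so
  that \<open>X\<close> can be recognised as a message.\<close>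

lemma E_eq_cases:
  assumes "E_eq E M N"
    and "P M"
    and "\<And>X Y. E_eq E M X \<Longrightarrow> ac_eq E X Y \<Longrightarrow> P X \<Longrightarrow> P Y"
    and "\<And>X Y. E_eq E M X \<Longrightarrow> step E (rules E) X Y \<Longrightarrow> P X \<Longrightarrow> P Y"
    and "\<And>X Y. E_eq E M X \<Longrightarrow> step E (rules E) Y X \<Longrightarrow> P X \<Longrightarrow> P Y"
  shows "P N"
  using assms(1)[unfolded E_eq_def]
proof (induction rule: equivclp_induct)
  case base
  show ?case by (rule assms)
next
  case (step X Y)
  have M: "E_eq E M X"
    using step(1) by (simp add: E_eq_def)
  have split: "step E (ac_axioms E) U V \<or> step E (rules E) U V"
    if "step E (ac_axioms E \<union> rules E) U V" for U V
  proof -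
    have "rewrite (ac_axioms E) U V \<or> rewrite (rules E) U V"
      if "rewrite (ac_axioms E \<union> rules E) U V"
      using that by (induction rule: rewrite.induct) (auto intro: rewrite.intros)
    with that show ?thesis by (auto simp: step_def)
  qed
  have "ac_eq E X Y \<or> step E (rules E) X Y \<or> step E (rules E) Y X"
    using step(2) split[of X Y] split[of Y X]
    by (auto simp: ac_eq_def intro: r_into_equivclp converse_r_into_equivclp)
  with M step(3) show ?case
    using assms(3-5) by blast
qed

lemma immediate_subterm_context:
  assumes "M \<in> immediate_subterms N"
  obtains G where "N = G M"
    and "\<And>R P Q. message E N \<Longrightarrow> step E R P Q \<Longrightarrow> step E R (G P) (G Q)"
proof (cases N)
  case (Pub A)
  show thesis
    by (rule that[of Pub]) (use assms Pub in \<open>auto simp: step_def intro: rewrite.intros\<close>)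
next
  case (Sign A B)
  show thesis
  proof (cases "M = A")
    case True
    show thesis
      by (rule that[of "\<lambda>X. Sign X B"]) (use Sign True in \<open>auto simp: step_def intro: rewrite.intros\<close>)
  next
    case False
    show thesis
      by (rule that[of "\<lambda>X. Sign A X"])
        (use assms Sign False in \<open>auto simp: step_def intro: rewrite.intros\<close>)
  qed
next
  case (Blind A B)
  show thesis
  proof (cases "M = A")
    case True
    show thesis
      by (rule that[of "\<lambda>X. Blind X B"]) (use Blind True in \<open>auto simp: step_def intro: rewrite.intros\<close>)
  next
    case False
    show thesis
      by (rule that[of "\<lambda>X. Blind A X"])
        (use assms Blind False in \<open>auto simp: step_def intro: rewrite.intros\<close>)
  qed
next
  case (MPair A B)
  show thesis
  proof (cases "M = A")
    case True
    show thesis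
      by (rule that[of "\<lambda>X. MPair X B"]) (use MPair True in \<open>auto simp: step_def intro: rewrite.intros\<close>)
  next
    case False
    show thesis
      by (rule that[of "\<lambda>X. MPair A X"])
        (use assms MPair False in \<open>auto simp: step_def intro: rewrite.intros\<close>)
  qed
next
  case (Enc A B)
  show thesis
  proof (cases "M = A")
    case True
    show thesis
      by (rule that[of "\<lambda>X. Enc X B"]) (use Enc True in \<open>auto simp: step_def intro: rewrite.intros\<close>)
  next
    case False
    show thesis
      by (rule that[of "\<lambda>X. Enc A X"])
        (use assms Enc False in \<open>auto simp: step_def intro: rewrite.intros\<close>)
  qed
next
  case (Fun f Ms)
  with assms obtain Ps Qs where "Ms = Ps @ M # Qs"
    by (auto dest: split_list)
  with Fun show thesis
    by (intro that[of "\<lambda>X. Fun f (Ps @ X # Qs)"]) (auto simp: step_def intro: rewrite.intros)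
qed (use assms in simp_all)

lemma message_immediate_subterm:
  "M \<in> immediate_subterms N \<Longrightarrow> message E N \<Longrightarrow> message E M"
  by (cases N) auto

lemma ground_immediate_subterm: "M \<in> immediate_subterms N \<Longrightarrow> ground N \<Longrightarrow> ground M"
  by (cases N) (auto simp: ground_def)

lemma normal_immediate_subterm:
  assumes "M \<in> immediate_subterms N" and "message E N" and "normal E N"
  shows "normal E M"
proof (rule ccontr)
  assume "\<not> normal E M"
  then obtain M1 M2 M3 where s: "ac_eq E M M1" "step E (rules E) M1 M2" "ac_eq E M2 M3"
    by (auto simp: normal_def step_mod_ac_def)
  obtain G where N: "N = G M"
    and G: "\<And>R P Q. message E N \<Longrightarrow> step E R P Q \<Longrightarrow> step E R (G P) (G Q)"
    using immediate_subterm_context[OF assms(1), where E = E] by blast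
  have "step E R (G P) (G Q)" if "step E R P Q" for R P Q
    using that assms(2) by (blast intro: G)
  moreover have "ac_eq E (G P) (G Q)" if "ac_eq E P Q" for P Q
    unfolding ac_eq_def
    by (rule equivclp_map[OF that[unfolded ac_eq_def]]) (simp add: r_into_equivclp calculation)
  ultimately have "step_mod_ac E N (G M3)"
    using s N unfolding step_mod_ac_def by blast
  with assms(3) show False by (simp add: normal_def)
qed

lemma Fun_equiv_arg:
  assumes "equivclp (step E R) M M'" and "message E (Fun f (Ms @ M # Ns))"
  shows "equivclp (step E R) (Fun f (Ms @ M # Ns)) (Fun f (Ms @ M' # Ns))"
  by (rule equivclp_map[OF assms(1)])
    (use assms(2) in \<open>auto simp: step_def intro!: r_into_equivclp rewrite.intros\<close>)

lemma E_eq_Fun: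
  assumes "list_all2 (E_eq E) Ms Ms'" and "message E (Fun f Ms)"
  shows "E_eq E (Fun f Ms) (Fun f Ms')"
proof -
  \<comment> \<open>The arguments are exchanged one at a time from the left; the prefix
    \<open>Ps\<close> holds those already exchanged.\<close>
  have "E_eq E (Fun f (Ps @ Ms)) (Fun f (Ps @ Ms'))" if "message E (Fun f (Ps @ Ms))" for Ps
    using assms(1) that
  proof (induction arbitrary: Ps rule: list_all2_induct)
    case (Cons M Ms M' Ms')
    have "E_eq E (Fun f (Ps @ M # Ms)) (Fun f (Ps @ M' # Ms))"
      using Cons unfolding E_eq_def by (intro Fun_equiv_arg) auto
    moreover from this have "E_eq E (Fun f ((Ps @ [M']) @ Ms)) (Fun f ((Ps @ [M']) @ Ms'))"
      using Cons.prems E_eq_message[OF Cons.hyps(1)] by (intro Cons.IH) simp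
    ultimately show ?case
      by (auto intro: E_eq_trans)
  qed simp
  from this[of "[]"] show ?thesis using assms(2) by simp
qed

lemma message_subst_E_term:
  "E_term E t \<Longrightarrow> message E (subst \<sigma> t) \<longleftrightarrow> (\<forall>x\<in>vars t. message E (\<sigma> x))"
  by (induction t) auto

section \<open>Binary constructors\<close>

text \<open>Constructors as functions let one argument serve all four. \<open>Pub\<close> is
  excluded: the system has no right rule that builds it.\<close>

definition constrs :: "('f msg \<Rightarrow> 'f msg \<Rightarrow> 'f msg) set" where
  "constrs = {Sign, Blind, MPair, Enc}"

lemma constrsE:
  assumes "c \<in> constrs"
  obtains "c = Sign" | "c = Blind" | "c = MPair" | "c = Enc"
  using assms by (auto simp: constrs_def)

lemma constr_in_constrs [simp, intro]:
  "Sign \<in> constrs" "Blind \<in> constrs" "MPair \<in> constrs" "Enc \<in> constrs"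
  by (simp_all add: constrs_def)

lemma constr_immediate_subterms: "c \<in> constrs \<Longrightarrow> immediate_subterms (c P Q) = {P, Q}"
  by (auto elim: constrsE)

lemma constr_E_alien: "c \<in> constrs \<Longrightarrow> E_alien E (c P Q)"
  by (auto elim: constrsE)

lemma constr_message: "c \<in> constrs \<Longrightarrow> message E (c P Q) \<longleftrightarrow> message E P \<and> message E Q"
  by (auto elim: constrsE)

lemma constr_ground: "c \<in> constrs \<Longrightarrow> ground (c P Q) \<longleftrightarrow> ground P \<and> ground Q"
  by (auto elim: constrsE simp: ground_def)

lemma constr_inject:
  "c \<in> constrs \<Longrightarrow> c' \<in> constrs \<Longrightarrow> c P Q = c' P' Q' \<longleftrightarrow> c = c' \<and> P = P' \<and> Q = Q'"
  by (auto elim!: constrsE simp: fun_eq_iff)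

lemma rewrite_constr:
  assumes "rewrite R M N" and "c \<in> constrs" and "M = c P Q"
  shows "(\<exists>l r \<sigma>. (l, r) \<in> R \<and> M = subst \<sigma> l \<and> N = subst \<sigma> r)
    \<or> (\<exists>P'. rewrite R P P' \<and> N = c P' Q) \<or> (\<exists>Q'. rewrite R Q Q' \<and> N = c P Q')"
  using assms(2)
proof (rule constrsE)
  assume c: "c = Sign"
  show ?thesis
    using assms(1)[unfolded assms(3) c] assms(3) c by cases auto
next
  assume c: "c = Blind"
  show ?thesis
    using assms(1)[unfolded assms(3) c] assms(3) c by cases auto
next
  assume c: "c = MPair"
  show ?thesis
    using assms(1)[unfolded assms(3) c] assms(3) c by cases auto
next
  assume c: "c = Enc"
  show ?thesis
    using assms(1)[unfolded assms(3) c] assms(3) c by cases auto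
qed

lemma rewrite_constr_rev:
  assumes "rewrite R N M" and "c \<in> constrs" and "M = c P Q"
  shows "(\<exists>l r \<sigma>. (l, r) \<in> R \<and> N = subst \<sigma> l \<and> M = subst \<sigma> r)
    \<or> (\<exists>P'. rewrite R P' P \<and> N = c P' Q) \<or> (\<exists>Q'. rewrite R Q' Q \<and> N = c P Q')"
  using assms(2)
proof (rule constrsE)
  assume c: "c = Sign"
  show ?thesis
    using assms(1)[unfolded assms(3) c] assms(3) c by cases auto
next
  assume c: "c = Blind"
  show ?thesis
    using assms(1)[unfolded assms(3) c] assms(3) c by cases auto
next
  assume c: "c = MPair"
  show ?thesis
    using assms(1)[unfolded assms(3) c] assms(3) c by cases auto
next
  assume c: "c = Enc"
  show ?thesis
    using assms(1)[unfolded assms(3) c] assms(3) c by cases auto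
qed

lemma ac_eq_constrI:
  assumes "c \<in> constrs" and "ac_eq E P P'" and "ac_eq E Q Q'" and "message E P" "message E Q"
  shows "ac_eq E (c P Q) (c P' Q')"
proof -
  have msg: "message E P'"
    using assms(2,4) ac_eq_message by blast
  have "ac_eq E (c P Q) (c P' Q)"
    unfolding ac_eq_def
    by (rule equivclp_map[OF assms(2)[unfolded ac_eq_def]], rule r_into_equivclp, use assms(1) in
        \<open>rule constrsE\<close>) (use assms(5) in \<open>simp_all add: step_def rewrite.intros\<close>)
  moreover have "ac_eq E (c P' Q) (c P' Q')"
    unfolding ac_eq_def
    by (rule equivclp_map[OF assms(3)[unfolded ac_eq_def]], rule r_into_equivclp, use assms(1) in
        \<open>rule constrsE\<close>) (use msg in \<open>simp_all add: step_def rewrite.intros\<close>)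
  ultimately show ?thesis
    by (rule ac_eq_trans)
qed

lemma E_term_ac_axioms:
  "\<lbrakk>\<And>p. ac E = Some p \<Longrightarrow> sig E p = Some 2; (l, r) \<in> ac_axioms E\<rbrakk>
    \<Longrightarrow> E_term E l \<and> E_term E r \<and> vars r = vars l \<and> (\<exists>f Ms. l = Fun f Ms) \<and> (\<exists>f Ms. r = Fun f Ms)"
  by (auto simp: ac_axioms_def split: option.splits)

section \<open>Leaves of the top layer\<close>

text \<open>For a message, the leaves are its maximal subterms that are not headed by a symbol of the
  signature.\<close>

fun leaves :: "'f msg \<Rightarrow> 'f msg set" where
  "leaves (Fun f Ms) = (\<Union>M\<in>set Ms. leaves M)"
| "leaves (Name a) = {Name a}"
| "leaves (Var x) = {Var x}"
| "leaves (Pub M) = {Pub M}"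
| "leaves (Sign M N) = {Sign M N}"
| "leaves (Blind M N) = {Blind M N}"
| "leaves (MPair M N) = {MPair M N}"
| "leaves (Enc M N) = {Enc M N}"

fun map_leaves :: "('f msg \<Rightarrow> 'f msg) \<Rightarrow> 'f msg \<Rightarrow> 'f msg" where
  "map_leaves g (Fun f Ms) = Fun f (map (map_leaves g) Ms)"
| "map_leaves g (Name a) = g (Name a)"
| "map_leaves g (Var x) = g (Var x)"
| "map_leaves g (Pub M) = g (Pub M)"
| "map_leaves g (Sign M N) = g (Sign M N)"
| "map_leaves g (Blind M N) = g (Blind M N)"
| "map_leaves g (MPair M N) = g (MPair M N)"
| "map_leaves g (Enc M N) = g (Enc M N)"

lemma leaves_constr: "c \<in> constrs \<Longrightarrow> leaves (c P Q) = {c P Q}"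
  by (auto elim: constrsE)

lemma map_leaves_constr: "c \<in> constrs \<Longrightarrow> map_leaves g (c P Q) = g (c P Q)"
  by (auto elim: constrsE)

lemma map_leaves_id: "(\<And>A. A \<in> leaves M \<Longrightarrow> g A = A) \<Longrightarrow> map_leaves g M = M"
  by (induction M) (auto intro: map_idI)

lemma message_map_leaves:
  "(\<And>A. message E A \<Longrightarrow> message E (g A)) \<Longrightarrow> message E M \<Longrightarrow> message E (map_leaves g M)"
  by (induction M) auto

text \<open>E-terms consist of signature symbols and variables only, so all leaves of an instance
  come from the substituted messages.\<close>

lemma leaves_subst: "E_term E t \<Longrightarrow> leaves (subst \<sigma> t) = (\<Union>x\<in>vars t. leaves (\<sigma> x))"
  by (induction t) auto

lemma map_leaves_subst:
  "E_term E t \<Longrightarrow> map_leaves g (subst \<sigma> t) = subst (\<lambda>x. map_leaves g (\<sigma> x)) t"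
  by (induction t) auto

text \<open>Closure under the symbols of the signature: the instances of \<open>E\<close>-contexts.\<close>

inductive sig_closure :: "'f eq_theory \<Rightarrow> 'f msg set \<Rightarrow> 'f msg \<Rightarrow> bool"
  for E :: "'f eq_theory" and X :: "'f msg set"
where
  base: "M \<in> X \<Longrightarrow> sig_closure E X M"
| app: "sig E f = Some (length Ms) \<Longrightarrow> (\<And>M. M \<in> set Ms \<Longrightarrow> sig_closure E X M) \<Longrightarrow>
    sig_closure E X (Fun f Ms)"

lemma length_fills: "length (fills Cs Ms) = length Cs"
  by (induction Cs arbitrary: Ms) auto

lemma sig_closure_fill:
  "E_context E C \<Longrightarrow> length Ms = holes C \<Longrightarrow> set Ms \<subseteq> X \<Longrightarrow> sig_closure E X (fill C Ms)"
  and sig_closure_fills: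
  "\<forall>C\<in>set Cs. E_context E C \<Longrightarrow> length Ms = sum_list (map holes Cs) \<Longrightarrow> set Ms \<subseteq> X \<Longrightarrow>
    \<forall>M\<in>set (fills Cs Ms). sig_closure E X M"
proof (induction C Ms and Cs Ms rule: fill_fills.induct)
  case (1 Ms)
  then show ?case by (cases Ms) (auto intro: sig_closure.base)
next
  case (2 f Cs Ms)
  then show ?case by (auto intro: sig_closure.app simp: length_fills)
next
  case (4 C Cs Ms)
  then show ?case
    by (auto dest: in_set_takeD in_set_dropD)
qed simp

text \<open>Converse of \<open>sig_closure_fill\<close>: the hole fillings of the arguments are
  concatenated in order. The side condition of \<open>Id\<close> can thus be expressed by the
  inductive \<open>sig_closure\<close> instead of the positional \<open>fill\<close>.\<close>

lemma sig_closure_imp_fill: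
  "sig_closure E X M \<Longrightarrow> \<exists>C Ms. E_context E C \<and> length Ms = holes C \<and> set Ms \<subseteq> X \<and> M = fill C Ms"
proof (induction rule: sig_closure.induct)
  case (base M)
  then show ?case
    by (intro exI[of _ Hole] exI[of _ "[M]"]) auto
next
  case (app f Ms)
  have "\<exists>Cs Ns. length Cs = length Ms \<and> (\<forall>C\<in>set Cs. E_context E C) \<and>
      length Ns = sum_list (map holes Cs) \<and> set Ns \<subseteq> X \<and> Ms = fills Cs Ns"
    using app(3)
  proof (induction Ms)
    case Nil
    then show ?case by simp
  next
    case (Cons M Ms)
    obtain C Ls where C: "E_context E C" "length Ls = holes C" "set Ls \<subseteq> X" "M = fill C Ls"
      using Cons.prems[of M] by auto
    obtain Cs Ns where Cs: "length Cs = length Ms" "\<forall>C\<in>set Cs. E_context E C"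
      "length Ns = sum_list (map holes Cs)" "set Ns \<subseteq> X" "Ms = fills Cs Ns"
      using Cons by (metis list.set_intros(2))
    show ?case
      by (rule exI[of _ "C # Cs"], rule exI[of _ "Ls @ Ns"]) (use C Cs in auto)
  qed
  then obtain Cs Ns where "length Cs = length Ms" "\<forall>C\<in>set Cs. E_context E C"
    "length Ns = sum_list (map holes Cs)" "set Ns \<subseteq> X" "Ms = fills Cs Ns"
    by auto
  then show ?case
    by (intro exI[of _ "CFun f Cs"] exI[of _ Ns]) (use app(1) in auto)
qed

lemma sig_closure_finite:
  assumes "sig_closure E X M"
  shows "\<exists>Y. finite Y \<and> Y \<subseteq> X \<and> sig_closure E Y M"
  using sig_closure_imp_fill[OF assms] sig_closure_fill by (metis List.finite_set order_refl)

lemma sig_closure_mono: "sig_closure E X M \<Longrightarrow> X \<subseteq> Y \<Longrightarrow> sig_closure E Y M"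
  by (induction rule: sig_closure.induct) (auto intro: sig_closure.intros)

lemma sig_closure_message:
  "sig_closure E X M \<Longrightarrow> (\<And>x. x \<in> X \<Longrightarrow> message E x) \<Longrightarrow> message E M"
  by (induction rule: sig_closure.induct) auto

lemma sig_closure_leaves:
  "sig_closure E X M \<Longrightarrow> A \<in> leaves M \<Longrightarrow> \<exists>x\<in>X. A \<in> leaves x"
  by (induction rule: sig_closure.induct) auto

lemma sig_closure_of_leaves: "message E M \<Longrightarrow> sig_closure E (leaves M) M"
proof (induction M)
  case (Fun f Ms)
  then show ?case
    by (auto intro!: sig_closure.app) (meson UN_upper sig_closure_mono)
qed (auto intro: sig_closure.base)

lemma sig_closure_map_leaves:
  "sig_closure E X M \<Longrightarrow> sig_closure E (map_leaves g ` X) (map_leaves g M)"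
  by (induction rule: sig_closure.induct) (auto intro: sig_closure.base intro!: sig_closure.app)

text \<open>Contexts respect \<open>E_eq\<close>, and contexts filled with contexts are
  contexts.\<close>

lemma sig_closure_E_eq:
  assumes "sig_closure E X M" and "\<And>x. x \<in> X \<Longrightarrow> message E x"
    and "\<And>x. x \<in> X \<Longrightarrow> \<exists>t. E_eq E x t \<and> sig_closure E Y t"
  shows "\<exists>t. E_eq E M t \<and> sig_closure E Y t"
  using assms(1)
proof (induction rule: sig_closure.induct)
  case (base M)
  then show ?case by (rule assms(3))
next
  case (app f Ms)
  then obtain t where t: "\<And>M. M \<in> set Ms \<Longrightarrow> E_eq E M (t M) \<and> sig_closure E Y (t M)"
    by metis
  have "message E (Fun f Ms)"
    using app assms(2) by (auto intro: sig_closure_message)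
  then have "E_eq E (Fun f Ms) (Fun f (map t Ms))"
    by (intro E_eq_Fun) (auto simp: list_all2_conv_all_nth t)
  moreover have "sig_closure E Y (Fun f (map t Ms))"
    using app(1) t by (auto intro!: sig_closure.app)
  ultimately show ?case by blast
qed

section \<open>Subterms and factors\<close>

lemma subterm_refl [simp, intro]: "subterm M M"
  by (simp add: subterm_def)

lemma subterm_trans: "subterm M N \<Longrightarrow> subterm N P \<Longrightarrow> subterm M P"
  unfolding subterm_def by (rule rtranclp_trans)

lemma immediate_subterm_subterm: "M \<in> immediate_subterms N \<Longrightarrow> subterm M N"
  unfolding subterm_def by (rule r_into_rtranclp)

lemma subterm_cases:
  "subterm M N \<Longrightarrow> M = N \<or> (\<exists>P \<in> immediate_subterms N. subterm M P)"
  unfolding subterm_def by (erule rtranclp.cases) auto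

lemma E_factor_subterm: "E_factor E A M \<Longrightarrow> subterm M N \<Longrightarrow> E_factor E A N"
  using subterm_trans[of _ M N] unfolding E_factor_def by blast

text \<open>The signature-headed parent of a factor cannot be \<open>c P Q\<close> itself, so it
  lies inside a component. This controls the factors of a message built afresh, such as
  \<open>Sign M K\<close> after unblinding.\<close>

lemma E_factor_constr:
  assumes "c \<in> constrs" and "E_factor E A (c P Q)"
  shows "E_factor E A P \<or> E_factor E A Q"
proof -
  obtain F where F: "E_alien E A" "subterm F (c P Q)" "sig_headed E F" "A \<in> immediate_subterms F"
    using assms(2) by (auto simp: E_factor_def)
  have "F \<noteq> c P Q"
    using F(3) by (rule contrapos_pn) (use assms(1) in \<open>auto simp: constrs_def\<close>)
  then have "subterm F P \<or> subterm F Q"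
    using subterm_cases[OF F(2)] assms(1) by (simp add: constr_immediate_subterms)
  moreover have "E_factor E A N" if "subterm F N" for N
    using that F subterm_trans[OF immediate_subterm_subterm[OF F(4)] that]
    unfolding E_factor_def by blast
  ultimately show ?thesis
    by blast
qed

lemma leaf_subterm: "A \<in> leaves M \<Longrightarrow> subterm A M"
proof (induction M)
  case (Fun f Ms)
  then obtain M where "M \<in> set Ms" "A \<in> leaves M"
    by auto
  with Fun.IH have "subterm M (Fun f Ms)" "subterm A M"
    by (simp_all add: immediate_subterm_subterm)
  then show ?case
    by (metis subterm_trans)
qed auto

text \<open>In a message, every symbol above a leaf belongs to the signature, so an alien leaf other
  than \<open>M\<close> has a signature-headed parent.\<close>

lemma leaf_E_factor:
  "A \<in> leaves M \<Longrightarrow> message E M \<Longrightarrow> E_alien E A \<Longrightarrow> A = M \<or> E_factor E A M"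
proof (induction M)
  case (Fun f Ms)
  then obtain M where M: "M \<in> set Ms" "A \<in> leaves M" "message E M"
    by auto
  have imm: "M \<in> immediate_subterms (Fun f Ms)"
    using M by simp
  show ?case
  proof (cases "A = M")
    case True
    then have "E_factor E A (Fun f Ms)"
      using Fun.prems imm immediate_subterm_subterm[OF imm] unfolding E_factor_def
      by (intro conjI exI[of _ "Fun f Ms"]) auto
    then show ?thesis ..
  next
    case False
    with Fun.IH M Fun.prems have "E_factor E A M"
      by blast
    then show ?thesis
      using E_factor_subterm[OF _ immediate_subterm_subterm[OF imm]] by blast
  qed
qed auto

definition good :: "'f eq_theory \<Rightarrow> 'f msg \<Rightarrow> bool" where
  "good E M \<longleftrightarrow> message E M \<and> ground M \<and> normal E M"

lemma goodD: "good E M \<Longrightarrow> message E M" "good E M \<Longrightarrow> ground M" "good E M \<Longrightarrow> normal E M"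
  by (simp_all add: good_def)

lemma good_subterm:
  assumes "subterm M N" and "good E N"
  shows "good E M"
  using assms(1)[unfolded subterm_def] assms(2)
proof (induction rule: converse_rtranclp_induct)
  case (step M N)
  then show ?case
    unfolding good_def
    using message_immediate_subterm ground_immediate_subterm normal_immediate_subterm by blast
qed

lemma good_E_factor: "E_factor E A M \<Longrightarrow> good E M \<Longrightarrow> good E A"
  by (auto simp: E_factor_def intro: good_subterm)

lemma good_constrD: "c \<in> constrs \<Longrightarrow> good E (c P Q) \<Longrightarrow> good E P \<and> good E Q"
  using good_subterm[OF immediate_subterm_subterm, of _ "c P Q" E]
  by (simp add: constr_immediate_subterms)

section \<open>Convergent theories\<close>

locale convergent =
  fixes E :: "'f eq_theory"
  assumes convergent: "ac_convergent_theory E"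
begin

lemma ac_axioms_wf:
  "(l, r) \<in> ac_axioms E \<Longrightarrow>
    E_term E l \<and> E_term E r \<and> vars r = vars l \<and> (\<exists>f Ms. l = Fun f Ms) \<and> (\<exists>f Ms. r = Fun f Ms)"
  by (rule E_term_ac_axioms) (use convergent in \<open>auto simp: ac_convergent_theory_def\<close>)

lemma rules_wf: "(l, r) \<in> rules E \<Longrightarrow> E_term E l \<and> E_term E r \<and> vars r \<subseteq> vars l"
  using convergent by (auto simp: ac_convergent_theory_def)

lemma axioms_wf:
  "(l, r) \<in> ac_axioms E \<union> rules E \<Longrightarrow> E_term E l \<and> E_term E r \<and> vars r \<subseteq> vars l"
  using ac_axioms_wf rules_wf by fastforce

text \<open>The Church-Rosser property modulo AC, by induction along the conversion; confluence is
  applied at the source \<open>X\<close> of a forward rule step.\<close>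

lemma E_eq_joinable:
  assumes "E_eq E M N" and "message E M"
  shows "\<exists>P Q. (step_mod_ac E)\<^sup>*\<^sup>* M P \<and> (step_mod_ac E)\<^sup>*\<^sup>* N Q \<and> ac_eq E P Q"
  using assms(1)
proof (cases rule: E_eq_cases[where P = "\<lambda>N. \<exists>P Q. (step_mod_ac E)\<^sup>*\<^sup>* M P \<and>
    (step_mod_ac E)\<^sup>*\<^sup>* N Q \<and> ac_eq E P Q", consumes 1, case_names refl ac rule rule_rev])
  case (ac X Y)
  then obtain P Q where PQ: "(step_mod_ac E)\<^sup>*\<^sup>* M P" "(step_mod_ac E)\<^sup>*\<^sup>* X Q" "ac_eq E P Q"
    by blast
  \<comment> \<open>If this reduction is empty, the AC step joins the final AC equality; otherwise
    the first reduction step absorbs it.\<close>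
  from PQ(2) show ?case
  proof (cases rule: converse_rtranclpE)
    case base
    then show ?thesis
      using PQ ac by (blast intro: ac_eq_trans)
  next
    case (step Z)
    then have "step_mod_ac E Y Z"
      using ac by (blast intro: ac_eq_step_mod_ac ac_eq_sym)
    then show ?thesis
      using PQ step by (blast intro: converse_rtranclp_into_rtranclp)
  qed
next
  case (rule X Y)
  then obtain P Q where PQ: "(step_mod_ac E)\<^sup>*\<^sup>* M P" "(step_mod_ac E)\<^sup>*\<^sup>* X Q" "ac_eq E P Q"
    by blast
  have "step_mod_ac E X Y"
    using rule(2) unfolding step_mod_ac_def by blast
  moreover have "message E X"
    using rule assms(2) E_eq_message by blast
  ultimately obtain Q' Z where QZ: "(step_mod_ac E)\<^sup>*\<^sup>* Q Q'" "(step_mod_ac E)\<^sup>*\<^sup>* Y Z" "ac_eq E Q' Z"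
    using convergent PQ(2) unfolding ac_convergent_theory_def confluent_mod_ac_def by blast
  from QZ(1) show ?case
  proof (cases rule: converse_rtranclpE)
    case base
    then show ?thesis
      using PQ QZ by (blast intro: ac_eq_trans)
  next
    case (step U)
    then have "step_mod_ac E P U"
      using PQ by (blast intro: ac_eq_step_mod_ac)
    then have "(step_mod_ac E)\<^sup>*\<^sup>* M Q'"
      using PQ(1) step by (meson converse_rtranclp_into_rtranclp rtranclp_trans)
    then show ?thesis
      using QZ by blast
  qed
next
  case (rule_rev X Y)
  then have "step_mod_ac E Y X"
    unfolding step_mod_ac_def by blast
  with rule_rev show ?case
    by (blast intro: converse_rtranclp_into_rtranclp)
qed auto

lemma normal_rtranclp: "(step_mod_ac E)\<^sup>*\<^sup>* M N \<Longrightarrow> normal E M \<Longrightarrow> N = M"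
  by (erule converse_rtranclpE) (auto simp: normal_def)

text \<open>Uniqueness of normal forms: neither side can reduce, so joinability collapses to AC
  equality.\<close>

lemma good_E_eq_imp_ac_eq:
  assumes "E_eq E M N" and "good E M" and "good E N"
  shows "ac_eq E M N"
  using E_eq_joinable[OF assms(1)] assms(2,3) by (auto simp: good_def dest: normal_rtranclp)

section \<open>Leaves under rewriting and AC equality\<close>

lemma leaves_rewrite:
  assumes "rewrite R P Q" and "message E P" and "message E Q" and "R \<subseteq> ac_axioms E \<union> rules E"
    and "A \<in> leaves Q"
  shows "\<exists>B\<in>leaves P. step E R B A \<or> A = B"
  using assms
proof (induction arbitrary: A rule: rewrite.induct)
  \<comment> \<open>A root step can duplicate, permute or drop leaves, but
    \<open>vars r \<subseteq> vars l\<close> keeps it from creating any. In the constructor cases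
    the leaf itself is rewritten.\<close>
  case (root l r \<sigma>)
  then have "E_term E l" "E_term E r" "vars r \<subseteq> vars l"
    using axioms_wf by blast+
  with root show ?case
    by (auto simp: leaves_subst)
next
  case ("fun" M M' f Ms Ns)
  show ?case
  proof (cases "A \<in> leaves M'")
    case True
    then have "\<exists>B\<in>leaves M. step E R B A \<or> A = B"
      using "fun" by simp
    then show ?thesis by auto
  qed (use "fun" in auto)
qed (auto simp: step_def intro: rewrite.intros)

text \<open>AC equality is symmetric, so leaves must be traced in both directions. This direction
  relies on \<open>vars r = vars l\<close>, which fails for rules that erase variables.\<close>

lemma leaves_rewrite_ac:
  assumes "rewrite R P Q" and "message E P" and "message E Q" and "R = ac_axioms E"
    and "A \<in> leaves P"
  shows "\<exists>B\<in>leaves Q. step E R A B \<or> A = B"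
  using assms
proof (induction arbitrary: A rule: rewrite.induct)
  case (root l r \<sigma>)
  then have "E_term E l" "E_term E r" "vars r = vars l"
    using ac_axioms_wf by blast+
  with root show ?case
    by (auto simp: leaves_subst)
next
  case ("fun" M M' f Ms Ns)
  show ?case
  proof (cases "A \<in> leaves M")
    case True
    then have "\<exists>B\<in>leaves M'. step E R A B \<or> A = B"
      using "fun" by simp
    then show ?thesis by auto
  qed (use "fun" in auto)
qed (auto simp: step_def intro: rewrite.intros)

lemma leaves_ac_eq:
  assumes "ac_eq E M N"
  shows "\<forall>A\<in>leaves N. \<exists>B\<in>leaves M. E_eq E A B"
  using assms unfolding ac_eq_def
proof (induction rule: equivclp_induct)
  case (step y z)
  have "\<exists>B\<in>leaves y. ac_eq E A B" if A: "A \<in> leaves z" for A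
    using step(2)
  proof
    assume *: "step E (ac_axioms E) y z"
    then obtain B where B: "B \<in> leaves y" "step E (ac_axioms E) B A \<or> A = B"
      using leaves_rewrite[of "ac_axioms E" y z A] A unfolding step_def by blast
    then have "ac_eq E A B"
      by (auto simp: ac_eq_def intro: converse_r_into_equivclp)
    with B(1) show ?thesis
      by blast
  next
    assume *: "step E (ac_axioms E) z y"
    then obtain B where B: "B \<in> leaves y" "step E (ac_axioms E) A B \<or> A = B"
      using leaves_rewrite_ac[of "ac_axioms E" z y A] A unfolding step_def by blast
    then have "ac_eq E A B"
      by (auto simp: ac_eq_def intro: r_into_equivclp)
    with B(1) show ?thesis
      by blast
  qed
  with step(3) show ?case
    by (meson E_eq_trans ac_eq_imp_E_eq)
qed auto

lemma leaves_step_rules: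
  assumes "step E (rules E) M N" and "A \<in> leaves N"
  shows "\<exists>B\<in>leaves M. E_eq E A B"
proof -
  obtain B where "B \<in> leaves M" "step E (rules E) B A \<or> A = B"
    using leaves_rewrite[of "rules E" M N A] assms unfolding step_def by blast
  then show ?thesis
    using step_rules_imp_E_eq E_eq_sym by blast
qed

lemma leaves_step_mod_ac:
  "step_mod_ac E M N \<Longrightarrow> A \<in> leaves N \<Longrightarrow> \<exists>B\<in>leaves M. E_eq E A B"
proof -
  assume "step_mod_ac E M N" and A: "A \<in> leaves N"
  then obtain U V where UV: "ac_eq E M U" "step E (rules E) U V" "ac_eq E V N"
    by (auto simp: step_mod_ac_def)
  obtain B where B: "B \<in> leaves V" "E_eq E A B"
    using leaves_ac_eq[OF UV(3)] A by blast
  obtain C where C: "C \<in> leaves U" "E_eq E B C"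
    using leaves_step_rules[OF UV(2) B(1)] by blast
  obtain D where "D \<in> leaves M" "E_eq E C D"
    using leaves_ac_eq[OF UV(1)] C(1) by blast
  then show ?thesis
    using E_eq_trans[OF E_eq_trans[OF B(2) C(2)]] by blast
qed

lemma leaves_reduces:
  "(step_mod_ac E)\<^sup>*\<^sup>* M N \<Longrightarrow> A \<in> leaves N \<Longrightarrow> \<exists>B\<in>leaves M. E_eq E A B"
proof (induction arbitrary: A rule: rtranclp_induct)
  case (step y z)
  obtain B where B: "B \<in> leaves y" "E_eq E A B"
    using leaves_step_mod_ac[OF step(2) step.prems] by blast
  from step.IH[OF B(1)] show ?case
    using E_eq_trans[OF B(2)] by blast
qed auto

text \<open>Since a rule creates no variables, reduction to normal form creates no new leaves.\<close>

lemma leaves_normal_form: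
  assumes "normal E M" and "message E M" and "E_eq E M N" and "A \<in> leaves M"
  shows "\<exists>B\<in>leaves N. E_eq E A B"
proof -
  obtain P Q where PQ: "(step_mod_ac E)\<^sup>*\<^sup>* M P" "(step_mod_ac E)\<^sup>*\<^sup>* N Q" "ac_eq E P Q"
    using E_eq_joinable assms by blast
  then have "P = M"
    using assms(1) normal_rtranclp by blast
  then obtain B where "B \<in> leaves Q" "E_eq E A B"
    using leaves_ac_eq[OF ac_eq_sym[OF PQ(3)]] assms(4) by blast
  then show ?thesis
    using leaves_reduces[OF PQ(2)] E_eq_trans[of E A B] by blast
qed

section \<open>Stability of \<open>E_eq\<close> under replacement of leaves\<close>

lemma map_leaves_rewrite:
  assumes "rewrite R P Q" and "R = ac_axioms E \<union> rules E" and "message E P" and "message E Q"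
    and g: "\<And>A. message E A \<Longrightarrow> message E (g A)" "\<And>A B. E_eq E A B \<Longrightarrow> E_eq E (g A) (g B)"
  shows "E_eq E (map_leaves g P) (map_leaves g Q)"
  using assms(1-4)
proof (induction rule: rewrite.induct)
  case (root l r \<sigma>)
  have wf: "E_term E l" "E_term E r" "vars r \<subseteq> vars l"
    using root axioms_wf by blast+
  \<comment> \<open>The leaves of an instance sit inside the substitution, so the replacement is
    pushed into \<open>\<sigma>\<close> and the step remains an instance of the same axiom.\<close>
  let ?\<sigma> = "\<lambda>x. map_leaves g (\<sigma> x)"
  have "message E (subst ?\<sigma> l)"
    using root.prems wf(1) by (auto simp: message_subst_E_term intro: message_map_leaves g)
  moreover from this have "message E (subst ?\<sigma> r)"
    using wf by (auto simp: message_subst_E_term)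
  ultimately have "step E R (subst ?\<sigma> l) (subst ?\<sigma> r)"
    using root.hyps by (auto simp: step_def intro: rewrite.root)
  then show ?case
    using wf root.prems(1) by (simp add: map_leaves_subst E_eq_def r_into_equivclp)
next
  case ("fun" M M' f Ms Ns)
  then have "message E (Fun f (map (map_leaves g) (Ms @ M # Ns)))"
    by (auto intro: message_map_leaves g)
  then show ?case
    using "fun" unfolding E_eq_def by (auto intro: Fun_equiv_arg)
\<comment> \<open>A step below a constructor turns one leaf into another, and \<open>g\<close>
  respects \<open>E_eq\<close>.\<close>
qed (simp only: map_leaves.simps, rule g(2), rule step_imp_E_eq, simp add: step_def rewrite.intros)+

lemma map_leaves_E_eq:
  assumes "E_eq E M N"
    and g: "\<And>A. message E A \<Longrightarrow> message E (g A)" "\<And>A B. E_eq E A B \<Longrightarrow> E_eq E (g A) (g B)"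
  shows "E_eq E (map_leaves g M) (map_leaves g N)"
proof -
  have "E_eq E (map_leaves g X) (map_leaves g Y)"
    if "step E (ac_axioms E \<union> rules E) X Y" for X Y
    by (rule map_leaves_rewrite[where R = "ac_axioms E \<union> rules E"])
      (use that g in \<open>auto simp: step_def\<close>)
  then show ?thesis
    using equivclp_map[OF assms(1)[unfolded E_eq_def], of _ "map_leaves g"] unfolding E_eq_def
    by blast
qed

section \<open>Constructors modulo AC and their normal forms\<close>

lemma ac_axioms_root_not_constr:
  assumes "(l, r) \<in> ac_axioms E" and "c \<in> constrs"
  shows "subst \<sigma> l \<noteq> c P Q" and "subst \<sigma> r \<noteq> c P Q"
  using ac_axioms_wf[OF assms(1)] assms(2) by (auto elim: constrsE)

lemma rewrite_ac_constr:
  assumes "rewrite (ac_axioms E) M N" and "c \<in> constrs"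
  shows "M = c P Q \<Longrightarrow> \<exists>P' Q'. N = c P' Q' \<and> (rewrite (ac_axioms E) P P' \<or> P = P') \<and>
      (rewrite (ac_axioms E) Q Q' \<or> Q = Q')"
    and "N = c P Q \<Longrightarrow> \<exists>P' Q'. M = c P' Q' \<and> (rewrite (ac_axioms E) P' P \<or> P = P') \<and>
      (rewrite (ac_axioms E) Q' Q \<or> Q = Q')"
proof -
  assume "M = c P Q"
  then show "\<exists>P' Q'. N = c P' Q' \<and> (rewrite (ac_axioms E) P P' \<or> P = P') \<and>
      (rewrite (ac_axioms E) Q Q' \<or> Q = Q')"
    using rewrite_constr[OF assms, of P Q] ac_axioms_root_not_constr(1)[OF _ assms(2), of _ _ _ P Q]
    by force
next
  assume "N = c P Q"
  then show "\<exists>P' Q'. M = c P' Q' \<and> (rewrite (ac_axioms E) P' P \<or> P = P') \<and>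
      (rewrite (ac_axioms E) Q' Q \<or> Q = Q')"
    using rewrite_constr_rev[OF assms, of P Q]
      ac_axioms_root_not_constr(2)[OF _ assms(2), of _ _ _ P Q] by force
qed

text \<open>Both sides of an AC axiom are headed by a function symbol, so every AC step acts inside
  one of the two components.\<close>

lemma ac_eq_constr:
  assumes "ac_eq E (c P Q) N" and "c \<in> constrs" and "message E (c P Q)"
  shows "\<exists>P' Q'. N = c P' Q' \<and> ac_eq E P P' \<and> ac_eq E Q Q'"
  using assms(1) unfolding ac_eq_def
proof (induction rule: equivclp_induct)
  case (step y z)
  then obtain P' Q' where y: "y = c P' Q'" "ac_eq E P P'" "ac_eq E Q Q'"
    by (auto simp: ac_eq_def)
  have "\<exists>P'' Q''. z = c P'' Q'' \<and> ac_eq E P' P'' \<and> ac_eq E Q' Q''"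
    using step.hyps(2)
  proof
    assume *: "step E (ac_axioms E) y z"
    then obtain P'' Q'' where z: "z = c P'' Q''" "rewrite (ac_axioms E) P' P'' \<or> P' = P''"
      "rewrite (ac_axioms E) Q' Q'' \<or> Q' = Q''"
      using rewrite_ac_constr(1)[OF _ assms(2) y(1), of z] unfolding step_def by blast
    with * y(1) assms(2) have "step E (ac_axioms E) P' P'' \<or> P' = P''"
      "step E (ac_axioms E) Q' Q'' \<or> Q' = Q''"
      by (auto simp: step_def constr_message)
    then have "ac_eq E P' P''" "ac_eq E Q' Q''"
      by (auto simp: ac_eq_def intro: r_into_equivclp)
    with z(1) show ?thesis
      by blast
  next
    assume *: "step E (ac_axioms E) z y"
    then obtain P'' Q'' where z: "z = c P'' Q''" "rewrite (ac_axioms E) P'' P' \<or> P' = P''"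
      "rewrite (ac_axioms E) Q'' Q' \<or> Q' = Q''"
      using rewrite_ac_constr(2)[OF _ assms(2) y(1), of z] unfolding step_def by blast
    with * y(1) assms(2) have "step E (ac_axioms E) P'' P' \<or> P' = P''"
      "step E (ac_axioms E) Q'' Q' \<or> Q' = Q''"
      by (auto simp: step_def constr_message)
    then have "ac_eq E P' P''" "ac_eq E Q' Q''"
      by (auto simp: ac_eq_def intro: converse_r_into_equivclp)
    with z(1) show ?thesis
      by blast
  qed
  then obtain P'' Q'' where "z = c P'' Q''" "ac_eq E P' P''" "ac_eq E Q' Q''"
    by blast
  then have "z = c P'' Q'' \<and> ac_eq E P P'' \<and> ac_eq E Q Q''"
    using ac_eq_trans[OF y(2)] ac_eq_trans[OF y(3)] by simp
  then show ?case
    unfolding ac_eq_def by (intro exI)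
next
  case base
  show ?case
    by (intro exI conjI) (rule refl equivclp_refl)+
qed

lemma ac_eq_Pub:
  assumes "ac_eq E (Pub P) N"
  shows "\<exists>P'. N = Pub P' \<and> ac_eq E P P'"
  using assms unfolding ac_eq_def
proof (induction rule: equivclp_induct)
  case (step y z)
  then obtain P' where y: "y = Pub P'" "ac_eq E P P'"
    by (auto simp: ac_eq_def)
  have "\<exists>P''. z = Pub P'' \<and> (step E (ac_axioms E) P' P'' \<or> step E (ac_axioms E) P'' P')"
    using step(2)
  proof
    assume *: "step E (ac_axioms E) y z"
    then have "rewrite (ac_axioms E) (Pub P') z"
      using y by (simp add: step_def)
    then show ?thesis
      using * y by cases (auto simp: step_def dest!: ac_axioms_wf)
  next
    assume *: "step E (ac_axioms E) z y"
    then have "rewrite (ac_axioms E) z (Pub P')"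
      using y by (simp add: step_def)
    then show ?thesis
      using * y by cases (auto simp: step_def dest!: ac_axioms_wf)
  qed
  with y show ?case
    by (auto simp: ac_eq_def intro: equivclp_into_equivclp)
qed auto

lemma E_alien_ac_eq:
  assumes "ac_eq E M N" and "E_alien E M" and "message E M"
  shows "E_alien E N"
proof (cases "\<exists>P. M = Pub P")
  case True
  then show ?thesis
    using assms(1) ac_eq_Pub by fastforce
next
  case False
  then obtain c P Q where c: "c \<in> constrs" "M = c P Q"
    using assms(2,3) by (cases M) (auto simp: constrs_def)
  then obtain P' Q' where "N = c P' Q'"
    using ac_eq_constr[of c P Q N] assms(1,3) by blast
  then show ?thesis
    using c(1) by (simp add: constr_E_alien)
qed

text \<open>Keeps the right rules among normal forms. Left-hand sides are E-terms, so only a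
  variable could match at the root, and then a component would reduce as well.\<close>

lemma normal_constr:
  assumes "c \<in> constrs" and "message E P" "message E Q" and "normal E P" "normal E Q"
  shows "normal E (c P Q)"
proof (rule ccontr)
  assume "\<not> normal E (c P Q)"
  then obtain U V where U: "ac_eq E (c P Q) U" and UV: "step E (rules E) U V"
    by (auto simp: normal_def step_mod_ac_def)
  obtain P' Q' where PQ: "U = c P' Q'" "ac_eq E P P'" "ac_eq E Q Q'"
    using ac_eq_constr[of c P Q U] U assms(1-3) by (auto simp: constr_message)
  have no_step: "\<not> step E (rules E) P' X" "\<not> step E (rules E) Q' X" for X
    using PQ(2,3) assms(4,5) unfolding normal_def step_mod_ac_def by blast+
  have msg: "message E P'" "message E Q'"
    using PQ assms(2,3) ac_eq_message by blast+
  have "rewrite (rules E) U V" "message E V"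
    using UV by (auto simp: step_def)
  from rewrite_constr[OF this(1) assms(1) PQ(1)] show False
  proof (elim disjE exE conjE)
    fix l r \<sigma>
    assume lr: "(l, r) \<in> rules E" "U = subst \<sigma> l"
    then have wf: "E_term E l" "E_term E r" "vars r \<subseteq> vars l"
      using rules_wf by blast+
    \<comment> \<open>A rule whose left-hand side is a variable would apply to every message, also to \<open>P'\<close>.\<close>
    obtain x where "l = Var x"
      using wf(1) lr(2) PQ(1) assms(1) by (cases l) (auto elim: constrsE)
    then have "rewrite (rules E) P' (subst (\<lambda>_. P') r)"
      using rewrite.root[OF lr(1), of "\<lambda>_. P'"] by simp
    moreover have "message E (subst (\<lambda>_. P') r)"
      using wf msg by (simp add: message_subst_E_term)
    ultimately show False
      using no_step(1) msg by (auto simp: step_def)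
  qed (use no_step msg \<open>message E V\<close> assms(1) in \<open>auto simp: step_def constr_message\<close>)
qed

lemma good_constr: "c \<in> constrs \<Longrightarrow> good E (c P Q) \<longleftrightarrow> good E P \<and> good E Q"
  using good_constrD[of c E P Q] normal_constr[of c P Q]
  by (auto simp: good_def constr_message constr_ground)

end

section \<open>Derivability\<close>

definition cut_free :: "'f eq_theory \<Rightarrow> 'f msg set \<Rightarrow> 'f msg \<Rightarrow> bool" where
  "cut_free E \<Gamma> M \<longleftrightarrow> (\<exists>d. derives E d (\<Gamma>, M) \<and> Cut \<notin> rules_used d)"

lemma cut_freeI:
  assumes "rule_inst E \<rho> Ss (\<Gamma>, M)" and "sequent E (\<Gamma>, M)" and "\<rho> \<noteq> Cut"
    and "\<And>\<Delta> N. (\<Delta>, N) \<in> set Ss \<Longrightarrow> cut_free E \<Delta> N"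
  shows "cut_free E \<Gamma> M"
proof -
  have "\<forall>S\<in>set Ss. \<exists>d. derives E d S \<and> Cut \<notin> rules_used d"
    using assms(4) by (force simp: cut_free_def)
  then obtain d where d: "\<forall>S\<in>set Ss. derives E (d S) S \<and> Cut \<notin> rules_used (d S)"
    by metis
  have "list_all2 (derives E) (map d Ss) Ss"
    using d by (simp add: list_all2_conv_all_nth)
  with assms(1,2) have "derives E (Infer \<rho> (map d Ss)) (\<Gamma>, M)"
    by (intro derives.intros)
  moreover have "Cut \<notin> rules_used (Infer \<rho> (map d Ss))"
    using d assms(3) by auto
  ultimately show ?thesis
    unfolding cut_free_def by blast
qed

text \<open>Derivations by \<open>Id\<close> and right rules never change the antecedent.
  \<open>\<Delta>\<close> may be infinite here, so that the union of all saturation stages can take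
  its place.\<close>

inductive right_derivable :: "'f eq_theory \<Rightarrow> 'f msg set \<Rightarrow> 'f msg \<Rightarrow> bool"
  for E :: "'f eq_theory" and \<Delta> :: "'f msg set"
where
  ident: "good E M \<Longrightarrow> E_eq E M t \<Longrightarrow> sig_closure E \<Delta> t \<Longrightarrow> right_derivable E \<Delta> M"
| constr: "c \<in> constrs \<Longrightarrow> right_derivable E \<Delta> P \<Longrightarrow> right_derivable E \<Delta> Q \<Longrightarrow>
    right_derivable E \<Delta> (c P Q)"

lemma right_derivable_mono: "right_derivable E \<Delta> M \<Longrightarrow> \<Delta> \<subseteq> \<Delta>' \<Longrightarrow> right_derivable E \<Delta>' M"
proof (induction rule: right_derivable.induct)
  case (ident M t)
  show ?case
    by (rule right_derivable.ident[OF ident(1,2) sig_closure_mono[OF ident(3,4)]])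
qed (simp add: right_derivable.constr)

text \<open>Compactness: contexts have finitely many holes. This brings results about the saturated
  set back to genuine sequents.\<close>

lemma right_derivable_finite:
  "right_derivable E \<Delta> M \<Longrightarrow> \<exists>\<Delta>'. finite \<Delta>' \<and> \<Delta>' \<subseteq> \<Delta> \<and> right_derivable E \<Delta>' M"
proof (induction rule: right_derivable.induct)
  case (ident M t)
  obtain \<Delta>' where "finite \<Delta>'" "\<Delta>' \<subseteq> \<Delta>" "sig_closure E \<Delta>' t"
    using sig_closure_finite[OF ident(3)] by blast
  then show ?case
    using right_derivable.ident[OF ident(1,2)] by blast
next
  case (constr c P Q)
  then obtain \<Delta>1 \<Delta>2 where *: "finite \<Delta>1" "\<Delta>1 \<subseteq> \<Delta>" "right_derivable E \<Delta>1 P"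
    "finite \<Delta>2" "\<Delta>2 \<subseteq> \<Delta>" "right_derivable E \<Delta>2 Q"
    by blast
  then have "right_derivable E (\<Delta>1 \<union> \<Delta>2) (c P Q)"
    using right_derivable.constr[OF constr(1)] right_derivable_mono[of E \<Delta>1 P "\<Delta>1 \<union> \<Delta>2"]
      right_derivable_mono[of E \<Delta>2 Q "\<Delta>1 \<union> \<Delta>2"] by simp
  then show ?case
    using * by (intro exI[of _ "\<Delta>1 \<union> \<Delta>2"]) simp
qed

context convergent
begin

lemma right_derivable_good: "right_derivable E \<Delta> M \<Longrightarrow> good E M"
  by (induction rule: right_derivable.induct) (simp, simp only: good_constr)

lemma right_derivable_cut_free:
  assumes "right_derivable E \<Delta> M" and "finite \<Delta>" and "\<And>x. x \<in> \<Delta> \<Longrightarrow> good E x"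
  shows "cut_free E \<Delta> M"
  using assms(1)
proof (induction rule: right_derivable.induct)
  case (ident M t)
  obtain C Ms where C: "E_context E C" "length Ms = holes C" "set Ms \<subseteq> \<Delta>" "t = fill C Ms"
    using sig_closure_imp_fill[OF ident(3)] by blast
  have "rule_inst E Id [] (\<Delta>, M)"
    by (rule rule_inst.intros(1)[OF C(1-3)]) (use ident(2) C(4) in simp)
  then show ?case
    by (rule cut_freeI) (use assms ident in \<open>auto simp: sequent_def good_def\<close>)
next
  case (constr c P Q)
  have "sequent E (\<Delta>, c P Q)"
    using assms(2,3) right_derivable_good[OF right_derivable.constr[OF constr(1-3)]]
    by (auto simp: sequent_def good_def)
  moreover have "\<exists>\<rho>. rule_inst E \<rho> [(\<Delta>, P), (\<Delta>, Q)] (\<Delta>, c P Q) \<and> \<rho> \<noteq> Cut"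
    using constr(1)
    \<comment> \<open>Introduction rules 4, 6, 8 and 10 are \<open>PR\<close>, \<open>ER\<close>,
      \<open>SignR\<close> and \<open>BlindR\<close>.\<close>
    by (rule constrsE) (hypsubst, intro exI conjI, rule rule_inst.intros(4,6,8,10), simp)+
  then obtain \<rho> where "rule_inst E \<rho> [(\<Delta>, P), (\<Delta>, Q)] (\<Delta>, c P Q)" "\<rho> \<noteq> Cut"
    by blast
  ultimately show ?case
    using constr.IH by (elim cut_freeI) auto
qed

end

text \<open>The messages that one of the left rules or \<open>acut\<close> adds to the antecedent, with side premises
  derived by right rules only.\<close>

inductive extension :: "'f eq_theory \<Rightarrow> 'f msg set \<Rightarrow> 'f msg set \<Rightarrow> 'f msg set \<Rightarrow> bool"
  for E :: "'f eq_theory" and \<Phi> :: "'f msg set" and \<Delta> :: "'f msg set"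
where
  pair: "MPair M N \<in> \<Delta> \<Longrightarrow> extension E \<Phi> \<Delta> {M, N}"
| enc: "Enc M K \<in> \<Delta> \<Longrightarrow> right_derivable E \<Delta> K \<Longrightarrow> extension E \<Phi> \<Delta> {M, K}"
| sign: "Sign M K \<in> \<Delta> \<Longrightarrow> Pub L \<in> \<Delta> \<Longrightarrow> ac_eq E K L \<Longrightarrow> extension E \<Phi> \<Delta> {M}"
| blind: "Blind M K \<in> \<Delta> \<Longrightarrow> right_derivable E \<Delta> K \<Longrightarrow> extension E \<Phi> \<Delta> {M, K}"
| unblind: "Sign (Blind M R) K \<in> \<Delta> \<Longrightarrow> right_derivable E \<Delta> R \<Longrightarrow>
    extension E \<Phi> \<Delta> {Sign M K, R}"
| factor: "A \<in> \<Phi> \<Longrightarrow> right_derivable E \<Delta> A \<Longrightarrow> extension E \<Phi> \<Delta> {A}"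

lemma extension_mono: "extension E \<Phi> \<Delta> D \<Longrightarrow> \<Delta> \<subseteq> \<Delta>' \<Longrightarrow> extension E \<Phi> \<Delta>' D"
  by (induction rule: extension.induct) (blast intro: extension.intros right_derivable_mono)+

lemma extension_finite:
  assumes "extension E \<Phi> \<Delta> D"
  shows "\<exists>\<Delta>'. finite \<Delta>' \<and> \<Delta>' \<subseteq> \<Delta> \<and> extension E \<Phi> \<Delta>' D"
proof -
  have *: "\<exists>\<Delta>'. finite \<Delta>' \<and> \<Delta>' \<subseteq> \<Delta> \<and> M \<in> \<Delta>' \<and> right_derivable E \<Delta>' K"
    if M: "M \<in> \<Delta>" and K: "right_derivable E \<Delta> K" for M K
  proof -
    obtain \<Delta>' where "finite \<Delta>'" "\<Delta>' \<subseteq> \<Delta>" "right_derivable E \<Delta>' K"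
      using right_derivable_finite[OF K] by blast
    then show ?thesis
      using M right_derivable_mono[of E \<Delta>' K "insert M \<Delta>'"]
      by (intro exI[of _ "insert M \<Delta>'"]) auto
  qed
  from assms show ?thesis
  proof cases
    case (pair M N)
    then show ?thesis
      by (intro exI[of _ "{MPair M N}"]) (auto intro: extension.pair)
  next
    case (enc M K)
    then show ?thesis
      using *[of "Enc M K" K] by (auto intro: extension.enc)
  next
    case (sign M K L)
    then show ?thesis
      by (intro exI[of _ "{Sign M K, Pub L}"]) (auto intro: extension.sign[of M K _ L])
  next
    case (blind M K)
    then show ?thesis
      using *[of "Blind M K" K] by (auto intro: extension.blind)
  next
    case (unblind M R K)
    then show ?thesis
      using *[of "Sign (Blind M R) K" R] by (auto intro: extension.unblind)
  next
    case (factor A)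
    then show ?thesis
      using right_derivable_finite[of E \<Delta> A] by (auto intro: extension.factor)
  qed
qed

section \<open>Saturation\<close>

locale saturation = convergent E for E :: "'f eq_theory" +
  fixes \<Gamma> :: "'f msg set" and T :: "'f msg"
  assumes seq: "sequent E (\<Gamma>, T)"
begin

abbreviation factors :: "'f msg set" where
  "factors \<equiv> {A. E_factor_of_set E A (\<Gamma> \<union> {T})}"

inductive reachable :: "'f msg set \<Rightarrow> bool" where
  start: "reachable \<Gamma>"
| extend: "reachable \<Delta> \<Longrightarrow> extension E factors \<Delta> D \<Longrightarrow> reachable (\<Delta> \<union> D)"

definition saturated :: "'f msg set" where
  "saturated = \<Union> (Collect reachable)"

text \<open>Layers alternate: an E-context is filled from \<open>X\<close>, whose elements are
  saturated or one constructor over known messages. As \<open>t\<close> is only E-equal to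
  \<open>M\<close>, normalisation is built in, while the leaves of \<open>t\<close> remain available
  for tracing.\<close>

inductive known :: "'f msg \<Rightarrow> bool" where
  "good E M \<Longrightarrow> E_eq E M t \<Longrightarrow> sig_closure E X t \<Longrightarrow>
    (\<And>x. x \<in> X \<Longrightarrow> x \<in> saturated \<or> (\<exists>c P Q. c \<in> constrs \<and> x = c P Q \<and> known P \<and> known Q)) \<Longrightarrow>
    known M"

lemma good_sequent: "M \<in> insert T \<Gamma> \<Longrightarrow> good E M"
  using seq by (auto simp: sequent_def good_def)

lemma good_factor: "A \<in> factors \<Longrightarrow> good E A"
  using good_sequent good_E_factor by (auto simp: E_factor_of_set_def)

lemma factors_factor: "A \<in> factors \<Longrightarrow> E_factor E B A \<Longrightarrow> B \<in> factors"
  using E_factor_subterm[of E B A] by (auto simp: E_factor_of_set_def E_factor_def[of E A])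

lemma reachable_superset: "reachable \<Delta> \<Longrightarrow> \<Gamma> \<subseteq> \<Delta>"
  by (induction rule: reachable.induct) auto

lemma reachable_finite: "reachable \<Delta> \<Longrightarrow> finite \<Delta>"
proof (induction rule: reachable.induct)
  case start
  then show ?case using seq by (simp add: sequent_def)
next
  case (extend \<Delta> D)
  then show ?case by (auto elim: extension.cases)
qed

text \<open>Additions are subterms of earlier members or elements of \<open>factors\<close>, so no
  new factors arise. The exception is \<open>Sign M K\<close> from unblinding, treated by
  \<open>E_factor_constr\<close>.\<close>

lemma reachable_good:
  "reachable \<Delta> \<Longrightarrow> x \<in> \<Delta> \<Longrightarrow> good E x \<and> (\<forall>A. E_factor E A x \<longrightarrow> A \<in> factors)"
proof (induction arbitrary: x rule: reachable.induct)
  case start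
  then show ?case
    using good_sequent by (auto simp: E_factor_of_set_def)
next
  case (extend \<Delta> D)
  define ok where "ok x \<longleftrightarrow> good E x \<and> (\<forall>A. E_factor E A x \<longrightarrow> A \<in> factors)" for x
  have ok: "ok x" if "x \<in> \<Delta>" for x
    using extend.IH[OF that] by (simp add: ok_def)
  have sub: "ok y" if "ok x" "y \<in> immediate_subterms x" for x y
    using that(1) good_subterm[OF immediate_subterm_subterm[OF that(2)]]
      E_factor_subterm[OF _ immediate_subterm_subterm[OF that(2)]] unfolding ok_def by blast
  from extend(2) have "\<forall>x\<in>D. ok x"
  proof cases
    case (unblind M R K)
    have "ok (Sign (Blind M R) K)"
      using ok[OF unblind(2)] .
    from sub[OF this] have "ok (Blind M R)" and K: "ok K"
      by simp_all
    from sub[OF this(1)] have *: "ok M" "ok R"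
      by simp_all
    have "ok (Sign M K)"
      using *(1) K E_factor_constr[of Sign E _ M K] unfolding ok_def
      by (simp add: good_constr) blast
    with * unblind show ?thesis by simp
  next
    case (factor A)
    then show ?thesis
      using good_factor[of A] factors_factor[of A] unfolding ok_def by blast
  next
    case (pair M N)
    from sub[OF ok[OF pair(2)]] show ?thesis
      by (simp add: pair(1))
  next
    case (enc M K)
    from sub[OF ok[OF enc(2)]] show ?thesis
      by (simp add: enc(1))
  next
    case (sign M K L)
    from sub[OF ok[OF sign(2)]] show ?thesis
      by (simp add: sign(1))
  next
    case (blind M K)
    from sub[OF ok[OF blind(2)]] show ?thesis
      by (simp add: blind(1))
  qed
  then show ?case
    using extend.prems ok[of x] unfolding ok_def by blast
qed

text \<open>The stages form a directed family: by monotonicity, the extensions leading to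
  \<open>\<Delta>\<close> can be replayed on top of \<open>\<Delta>'\<close>.\<close>

lemma reachable_Un:
  assumes "reachable \<Delta>" and "reachable \<Delta>'"
  shows "reachable (\<Delta> \<union> \<Delta>')"
  using assms(1)
proof (induction rule: reachable.induct)
  case start
  then show ?case
    using reachable_superset[OF assms(2)] assms(2) by (simp add: Un_absorb1)
next
  case (extend \<Delta> D)
  then have "reachable ((\<Delta> \<union> \<Delta>') \<union> D)"
    by (intro reachable.extend[OF extend.IH] extension_mono[OF extend.hyps(2)]) simp
  then show ?case
    by (simp add: Un_ac)
qed

lemma finite_subset_saturated:
  "finite X \<Longrightarrow> X \<subseteq> saturated \<Longrightarrow> \<exists>\<Delta>. reachable \<Delta> \<and> X \<subseteq> \<Delta>"
proof (induction rule: finite_induct)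
  case empty
  then show ?case using reachable.start by blast
next
  case (insert x X)
  then obtain \<Delta> \<Delta>' where "reachable \<Delta>" "X \<subseteq> \<Delta>" "reachable \<Delta>'" "x \<in> \<Delta>'"
    by (auto simp: saturated_def)
  then show ?case
    using reachable_Un by (intro exI[of _ "\<Delta> \<union> \<Delta>'"]) auto
qed

text \<open>An extension needs only finitely many members; by directedness one stage contains them
  all, and that stage can be extended.\<close>

lemma saturated_extension:
  assumes "extension E factors saturated D"
  shows "D \<subseteq> saturated"
proof -
  obtain X where X: "finite X" "X \<subseteq> saturated" "extension E factors X D"
    using extension_finite[OF assms] by blast
  obtain \<Delta> where \<Delta>: "reachable \<Delta>" "X \<subseteq> \<Delta>"
    using finite_subset_saturated[OF X(1,2)] by blast
  have "reachable (\<Delta> \<union> D)"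
    using \<Delta> X(3) by (blast intro: reachable.extend extension_mono)
  then show ?thesis
    unfolding saturated_def by blast
qed

lemma saturated_good: "x \<in> saturated \<Longrightarrow> good E x"
  using reachable_good by (auto simp: saturated_def)

lemma saturated_factor: "x \<in> saturated \<Longrightarrow> E_factor E A x \<Longrightarrow> A \<in> factors"
  using reachable_good unfolding saturated_def by blast

text \<open>Read backwards, each extension is a left rule or \<open>ACut\<close> whose side premise,
  if any, is right derivable and whose other premise keeps the goal \<open>T\<close>.\<close>

lemma reachable_cut_free:
  assumes "reachable \<Delta>" and "cut_free E \<Delta> T"
  shows "cut_free E \<Gamma> T"
  using assms
proof (induction rule: reachable.induct)
  case (extend \<Delta> D)
  have good: "good E x" if "x \<in> \<Delta>" for x
    using reachable_good extend(1) that by blast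
  have s: "sequent E (\<Delta>, T)"
    using good reachable_finite[OF extend(1)] good_sequent[of T]
    by (auto simp: sequent_def good_def)
  have side: "cut_free E \<Delta> K" if "right_derivable E \<Delta> K" for K
    using right_derivable_cut_free that good reachable_finite[OF extend(1)] by blast
  have prem: "cut_free E (\<Delta> \<union> D) T"
    by (rule extend.prems)
  from extend(2) have "cut_free E \<Delta> T"
  proof cases
    case (pair M N)
    \<comment> \<open>The rules display the principal message next to a context; as it already lies
      in \<open>\<Delta>\<close>, all of \<open>\<Delta>\<close> can be that context.\<close>
    then have "insert (MPair M N) \<Delta> = \<Delta>" "\<Delta> \<union> D = {MPair M N, M, N} \<union> \<Delta>"
      by auto
    then have "rule_inst E PL [(\<Delta> \<union> D, T)] (\<Delta>, T)"
      using rule_inst.intros(3)[of E M N \<Delta> T] by simp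
    then show ?thesis
      by (rule cut_freeI) (use s prem in auto)
  next
    case (enc M K)
    then have "insert (Enc M K) \<Delta> = \<Delta>" "\<Delta> \<union> D = {Enc M K, M, K} \<union> \<Delta>"
      by auto
    then have "rule_inst E EL [(\<Delta>, K), (\<Delta> \<union> D, T)] (\<Delta>, T)"
      using rule_inst.intros(5)[of E M K \<Delta> T] by simp
    then show ?thesis
      by (rule cut_freeI) (use s prem side enc in auto)
  next
    case (sign M K L)
    then have "insert (Sign M K) (insert (Pub L) \<Delta>) = \<Delta>" "\<Delta> \<union> D = {Sign M K, Pub L, M} \<union> \<Delta>"
      by auto
    then have "rule_inst E SignL [(\<Delta> \<union> D, T)] (\<Delta>, T)"
      using rule_inst.intros(7)[OF sign(4), of M \<Delta> T] by simp
    then show ?thesis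
      by (rule cut_freeI) (use s prem in auto)
  next
    case (blind M K)
    then have "insert (Blind M K) \<Delta> = \<Delta>" "\<Delta> \<union> D = {Blind M K, M, K} \<union> \<Delta>"
      by auto
    then have "rule_inst E BlindL1 [(\<Delta>, K), (\<Delta> \<union> D, T)] (\<Delta>, T)"
      using rule_inst.intros(9)[of E M K \<Delta> T] by simp
    then show ?thesis
      by (rule cut_freeI) (use s prem side blind in auto)
  next
    case (unblind M R K)
    then have "insert (Sign (Blind M R) K) \<Delta> = \<Delta>"
      "\<Delta> \<union> D = {Sign (Blind M R) K, Sign M K, R} \<union> \<Delta>"
      by auto
    then have "rule_inst E BlindL2 [(\<Delta>, R), (\<Delta> \<union> D, T)] (\<Delta>, T)"
      using rule_inst.intros(11)[of E M R K \<Delta> T] by simp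
    then show ?thesis
      by (rule cut_freeI) (use s prem side unblind in auto)
  next
    case (factor A)
    then have "E_factor_of_set E A (\<Delta> \<union> {T})"
      using reachable_superset[OF extend(1)] by (auto simp: E_factor_of_set_def)
    then have "rule_inst E ACut [(\<Delta>, A), (\<Delta> \<union> D, T)] (\<Delta>, T)"
      using rule_inst.intros(12)[of E A \<Delta> T] factor by simp
    then show ?thesis
      by (rule cut_freeI) (use s prem side factor in auto)
  qed
  then show ?case
    by (rule extend.IH)
qed

lemma right_derivable_saturated_cut_free:
  assumes "right_derivable E saturated T"
  shows "cut_free E \<Gamma> T"
proof -
  obtain X where X: "finite X" "X \<subseteq> saturated" "right_derivable E X T"
    using right_derivable_finite[OF assms] by blast
  obtain \<Delta> where \<Delta>: "reachable \<Delta>" "X \<subseteq> \<Delta>"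
    using finite_subset_saturated[OF X(1,2)] by blast
  have "cut_free E \<Delta> T"
    using right_derivable_cut_free[OF right_derivable_mono[OF X(3) \<Delta>(2)]]
      reachable_finite[OF \<Delta>(1)] reachable_good[OF \<Delta>(1)] by blast
  then show ?thesis
    by (rule reachable_cut_free[OF \<Delta>(1)])
qed

section \<open>Composition of known messages\<close>

lemma known_good: "known M \<Longrightarrow> good E M"
  by (erule known.cases) simp

lemma known_ac_eq:
  assumes "known M" and "ac_eq E M N" and "good E N"
  shows "known N"
  using assms(1)
proof cases
  case (1 t X)
  show ?thesis
    by (rule known.intros[OF assms(3) _ 1(3) 1(4)])
      (use E_eq_trans[OF ac_eq_imp_E_eq[OF ac_eq_sym[OF assms(2)]] 1(2)] in auto)
qed

lemma saturated_known: "x \<in> saturated \<Longrightarrow> known x"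
  by (rule known.intros[of _ x "{x}"]) (auto intro: saturated_good sig_closure.base)

lemma saturated_known_ac_eq: "x \<in> saturated \<Longrightarrow> ac_eq E x M \<Longrightarrow> good E M \<Longrightarrow> known M"
  using saturated_known known_ac_eq by blast

lemma known_constr: "c \<in> constrs \<Longrightarrow> known P \<Longrightarrow> known Q \<Longrightarrow> known (c P Q)"
  by (rule known.intros[of _ "c P Q" "{c P Q}"])
    (auto simp: good_constr known_good intro: sig_closure.base)

text \<open>Unfolding each \<open>known x\<close> once gives contexts over saturated or composed
  messages; plugged into the outer context they form the single layer that \<open>known\<close>
  demands.\<close>

lemma known_context:
  assumes "good E M" and "E_eq E M t" and "sig_closure E X t" and "\<And>x. x \<in> X \<Longrightarrow> known x"
  shows "known M"
proof -
  define Y where "Y = {y. y \<in> saturated \<or> (\<exists>c P Q. c \<in> constrs \<and> y = c P Q \<and> known P \<and> known Q)}"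
  have "\<exists>t'. E_eq E x t' \<and> sig_closure E Y t'" if "x \<in> X" for x
    using assms(4)[OF that]
  proof cases
    case (1 t X)
    then have "X \<subseteq> Y"
      by (auto simp: Y_def)
    with 1 show ?thesis
      using sig_closure_mono by blast
  qed
  then obtain t' where t': "E_eq E t t'" "sig_closure E Y t'"
    using sig_closure_E_eq[OF assms(3), of Y] assms(4) known_good goodD by metis
  show ?thesis
    by (rule known.intros[OF assms(1) E_eq_trans[OF assms(2) t'(1)] t'(2)]) (auto simp: Y_def)
qed

text \<open>Alien leaves occurring neither in the conclusion nor in the saturated set can be replaced by
  an arbitrary message, since \<open>E\<close>-equality is stable under such replacements.\<close>

lemma known_right_derivable:
  assumes "known M" and "good E M'" and "ac_eq E M' M"
    and "\<And>A. E_factor E A M' \<Longrightarrow> A \<in> factors"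
  shows "right_derivable E saturated M'"
  using assms
proof (induction arbitrary: M' rule: known.induct)
  case (1 M t X)
  define composite where "composite x \<longleftrightarrow> (\<exists>c P Q. c \<in> constrs \<and> x = c P Q)" for x :: "'f msg"
  have X: "x \<in> saturated \<or> composite x" if "x \<in> X" for x
    using 1(4)[OF that] by (auto simp: composite_def)
  have X_good: "good E x" if "x \<in> X" for x
    using 1(4)[OF that] by (auto simp: saturated_good good_constr known_good)
  \<comment> \<open>Elements of \<open>X\<close> outside the saturated set are composed. A good
    message E-equal to one splits into AC-equal components, to which the induction hypotheses
    apply.\<close>
  have derivable: "right_derivable E saturated A"
    if x: "x \<in> X" "x \<notin> saturated" and A: "E_eq E A x" "good E A"
      and A_fac: "\<And>B. E_factor E B A \<Longrightarrow> B \<in> factors" for x A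
  proof -
    obtain c P Q where c: "c \<in> constrs" "x = c P Q"
      and IH_P: "\<And>P'. good E P' \<Longrightarrow> ac_eq E P' P \<Longrightarrow> (\<And>A. E_factor E A P' \<Longrightarrow> A \<in> factors) \<Longrightarrow>
        right_derivable E saturated P'"
      and IH_Q: "\<And>Q'. good E Q' \<Longrightarrow> ac_eq E Q' Q \<Longrightarrow> (\<And>A. E_factor E A Q' \<Longrightarrow> A \<in> factors) \<Longrightarrow>
        right_derivable E saturated Q'"
      using 1(4)[OF x(1)] x(2) by blast
    have "ac_eq E (c P Q) A"
      using good_E_eq_imp_ac_eq[OF A X_good[OF x(1)]] c(2) ac_eq_sym by blast
    then obtain P' Q' where A': "A = c P' Q'" "ac_eq E P P'" "ac_eq E Q Q'"
      using ac_eq_constr c X_good[OF x(1)] goodD(1) by blast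
    have sub: "subterm P' A" "subterm Q' A"
      using A'(1) c(1) by (auto intro!: immediate_subterm_subterm simp: constr_immediate_subterms)
    have "right_derivable E saturated P'"
      using IH_P[of P'] good_subterm[OF sub(1) A(2)] ac_eq_sym[OF A'(2)] A_fac
        E_factor_subterm[OF _ sub(1)] by blast
    moreover have "right_derivable E saturated Q'"
      using IH_Q[of Q'] good_subterm[OF sub(2) A(2)] ac_eq_sym[OF A'(3)] A_fac
        E_factor_subterm[OF _ sub(2)] by blast
    ultimately show ?thesis
      using A'(1) c(1) right_derivable.constr by blast
  qed
  have M't: "E_eq E M' t"
    using E_eq_trans[OF ac_eq_imp_E_eq[OF 1(6)] 1(2)] .
  \<comment> \<open>Marks what is to be replaced: messages that match an element of \<open>X\<close>
    but no saturated match of that element, up to \<open>E_eq\<close>.\<close>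
  define bad where "bad A \<longleftrightarrow> (\<exists>x\<in>X. E_eq E A x \<and> (\<forall>w\<in>saturated. \<not> E_eq E w x))" for A
  show ?case
  proof (cases "bad M'")
    \<comment> \<open>A bad \<open>M'\<close> need not be a factor, so it is composed directly by a
      right rule.\<close>
    case True
    then obtain x where "x \<in> X" "E_eq E M' x" "x \<notin> saturated"
      unfolding bad_def by blast
    then show ?thesis
      using derivable 1(5,7) by blast
  next
    case False
    \<comment> \<open>A bad leaf of \<open>N\<close> would be alien and different from
      \<open>N\<close>, hence a factor; \<open>acut\<close> would put it into the saturated set,
      contradicting badness. \<open>N\<close> is first \<open>M'\<close>, then any saturated
      message.\<close>
    have not_bad: "\<not> bad A"
      if "A \<in> leaves N" "good E N" "\<not> bad N" "\<And>B. E_factor E B N \<Longrightarrow> B \<in> factors" for A N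
    proof
      assume "bad A"
      then obtain x where x: "x \<in> X" "E_eq E A x" "\<forall>w\<in>saturated. \<not> E_eq E w x"
        unfolding bad_def by blast
      then have "x \<notin> saturated"
        by blast
      then have "composite x"
        using X x(1) by blast
      have gA: "good E A"
        using good_subterm[OF leaf_subterm[OF that(1)] that(2)] .
      have "ac_eq E x A"
        using good_E_eq_imp_ac_eq[OF E_eq_sym[OF x(2)] X_good[OF x(1)] gA] .
      then have "E_alien E A"
        using \<open>composite x\<close> ac_eq_constr constr_E_alien goodD(1)[OF X_good[OF x(1)]]
        unfolding composite_def by blast
      moreover have "A \<noteq> N"
        using \<open>bad A\<close> that(3) by blast
      ultimately have A: "A \<in> factors"
        using leaf_E_factor[OF that(1) goodD(1)[OF that(2)]] that(4) by blast
      then have "right_derivable E saturated A"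
        using derivable[OF x(1) \<open>x \<notin> saturated\<close> x(2) gA] factors_factor by blast
      then have "A \<in> saturated"
        using saturated_extension[OF extension.factor[OF A]] by blast
      with x show False
        by blast
    qed
    have M'_not_bad: "\<not> bad A" if "A \<in> leaves M'" for A
      using not_bad[OF that 1(5) False] 1(7) by blast
    have sat_not_bad: "\<not> bad A" if "w \<in> saturated" "A \<in> leaves w" for w A
    proof (rule not_bad[OF that(2) saturated_good[OF that(1)]])
      show "\<not> bad w"
        using that(1) unfolding bad_def by blast
    qed (rule saturated_factor[OF that(1)])
    show ?thesis
    \<comment> \<open>The replacement needs some saturated message. Without one, every leaf of
      \<open>M'\<close> would be bad, so \<open>M'\<close> is built from signature symbols
      alone.\<close>
    proof (cases "saturated = {}")
      case True
      have "leaves M' = {}"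
      proof (rule ccontr)
        assume "leaves M' \<noteq> {}"
        then obtain A where A: "A \<in> leaves M'"
          by blast
        then obtain B where B: "B \<in> leaves t" "E_eq E A B"
          using leaves_normal_form[OF goodD(3,1)[OF 1(5)] M't] 1(5) by blast
        then obtain x where x: "x \<in> X" "B \<in> leaves x"
          using sig_closure_leaves[OF 1(3)] by blast
        then have "B = x"
          using X[OF x(1)] True leaves_constr unfolding composite_def by blast
        then have "bad A"
          using x B True unfolding bad_def by blast
        with M'_not_bad A show False
          by blast
      qed
      then have "sig_closure E saturated M'"
        using sig_closure_of_leaves[OF goodD(1)[OF 1(5)]] True by simp
      then show ?thesis
        using right_derivable.ident[OF 1(5)] by blast
    next
      case False
      then obtain w0 where w0: "w0 \<in> saturated"
        by blast
      define g where "g A = (if bad A then w0 else A)" for A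
      have bad_E_eq: "bad A \<longleftrightarrow> bad B" if "E_eq E A B" for A B
        unfolding bad_def using E_eq_trans[OF that] E_eq_trans[OF E_eq_sym[OF that]] by blast
      have g_msg: "message E (g A)" if "message E A" for A
        using that goodD(1)[OF saturated_good[OF w0]] by (simp add: g_def)
      have g_E_eq: "E_eq E (g A) (g B)" if "E_eq E A B" for A B
        using that bad_E_eq[OF that] by (simp add: g_def)
      have map_g: "E_eq E (map_leaves g P) (map_leaves g Q)" if "E_eq E P Q" for P Q
        by (rule map_leaves_E_eq[OF that]) (fact g_msg g_E_eq)+
      have "map_leaves g M' = M'"
        using M'_not_bad by (intro map_leaves_id) (simp add: g_def)
      then have gt: "E_eq E M' (map_leaves g t)"
        using map_g[OF M't] by simp
      \<comment> \<open>Each replaced filling is E-equal to a saturated message: a filling that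
        matches some \<open>w\<close> still does, since \<open>g\<close> fixes the leaves of
        \<open>w\<close>, and every other one collapses to \<open>w0\<close>.\<close>
      have "\<exists>w. E_eq E y w \<and> sig_closure E saturated w" if y: "y \<in> map_leaves g ` X" for y
      proof -
        obtain x where x: "x \<in> X" "y = map_leaves g x"
          using y by blast
        show ?thesis
        proof (cases "\<exists>w\<in>saturated. E_eq E w x")
          case True
          then obtain w where w: "w \<in> saturated" "E_eq E w x"
            by blast
          have "map_leaves g w = w"
            using sat_not_bad[OF w(1)] by (intro map_leaves_id) (simp add: g_def)
          then have "E_eq E y w"
            using map_g[OF E_eq_sym[OF w(2)]] x(2) by simp
          then show ?thesis
            using w(1) sig_closure.base by blast
        next
          case False
          then have "x \<notin> saturated"
            by blast
          then have "composite x"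
            using X[OF x(1)] by blast
          moreover have "bad x"
            using False x(1) unfolding bad_def by blast
          ultimately have "y = w0"
            using x(2) by (auto simp: composite_def map_leaves_constr g_def)
          then show ?thesis
            using w0 sig_closure.base by blast
        qed
      qed
      moreover have "message E y" if "y \<in> map_leaves g ` X" for y
        using that by (auto intro: message_map_leaves g_msg goodD(1) X_good)
      ultimately obtain t' where "E_eq E (map_leaves g t) t'" "sig_closure E saturated t'"
        using sig_closure_E_eq[OF sig_closure_map_leaves[OF 1(3)], of g saturated] by blast
      then show ?thesis
        using right_derivable.ident[OF 1(5)] E_eq_trans[OF gt] by blast
    qed
  qed
qed

section \<open>Decomposition of known messages\<close>

lemma known_alien:
  assumes "known M" and "E_alien E M"
  shows "(\<exists>w\<in>saturated. ac_eq E w M) \<or> (\<exists>c P Q. c \<in> constrs \<and> M = c P Q \<and> known P \<and> known Q)"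
  using assms(1)
proof cases
  case (1 t X)
  \<comment> \<open>An alien message is its own leaf, so it is traced, modulo E, to a leaf
    \<open>B\<close> of some filling \<open>x\<close>.\<close>
  have "M \<in> leaves M"
    using assms(2) goodD(1)[OF 1(1)] by (cases M) auto
  then obtain B where B: "B \<in> leaves t" "E_eq E M B"
    using leaves_normal_form[OF goodD(3,1)[OF 1(1)] 1(2)] 1(1) by blast
  then obtain x where x: "x \<in> X" "B \<in> leaves x"
    using sig_closure_leaves[OF 1(3)] by blast
  have gx: "good E x"
    using 1(4)[OF x(1)] by (auto simp: saturated_good good_constr known_good)
  have gB: "good E B"
    using good_subterm[OF leaf_subterm[OF x(2)] gx] .
  have MB: "ac_eq E M B"
    using good_E_eq_imp_ac_eq[OF B(2) 1(1) gB] .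
  show ?thesis
    using 1(4)[OF x(1)]
  proof
    assume sat: "x \<in> saturated"
    \<comment> \<open>If \<open>B\<close> is not \<open>x\<close>, it is a factor of
      \<open>x\<close>; being AC-equal to a known message it is right derivable, and saturation
      under \<open>acut\<close> adds it.\<close>
    have "B \<in> saturated"
    proof (cases "B = x")
      case False
      have "E_alien E B"
        using E_alien_ac_eq[OF MB assms(2) goodD(1)[OF 1(1)]] .
      then have "E_factor E B x"
        using leaf_E_factor[OF x(2) goodD(1)[OF gx]] False by blast
      then have B_fac: "B \<in> factors"
        by (rule saturated_factor[OF sat])
      have "right_derivable E saturated B"
        using known_right_derivable[OF assms(1) gB ac_eq_sym[OF MB]] factors_factor[OF B_fac]
        by blast
      then show ?thesis
        using saturated_extension[OF extension.factor[OF B_fac]] by blast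
    qed (use sat in simp)
    then show ?thesis
      using ac_eq_sym[OF MB] by blast
  next
    assume "\<exists>c P Q. c \<in> constrs \<and> x = c P Q \<and> known P \<and> known Q"
    then obtain c P Q where c: "c \<in> constrs" "x = c P Q" "known P" "known Q"
      by blast
    then have "B = c P Q"
      using x(2) leaves_constr by blast
    then obtain P' Q' where M: "M = c P' Q'" "ac_eq E P P'" "ac_eq E Q Q'"
      using ac_eq_constr[of c P Q M] ac_eq_sym[OF MB] c(1) gB goodD(1) by blast
    then have "known P'" "known Q'"
      using c known_ac_eq good_constr[OF c(1)] 1(1) by blast+
    with M(1) c(1) show ?thesis
      by blast
  qed
qed

lemma known_constr_cases:
  assumes "known (c P Q)" and "c \<in> constrs"
  obtains P' Q' where "c P' Q' \<in> saturated" "ac_eq E P' P" "ac_eq E Q' Q"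
  | "known P" "known Q"
proof -
  have gd: "good E (c P Q)"
    using known_good[OF assms(1)] .
  consider w where "w \<in> saturated" "ac_eq E w (c P Q)"
    | c' P' Q' where "c' \<in> constrs" "c P Q = c' P' Q'" "known P'" "known Q'"
    using known_alien[OF assms(1) constr_E_alien[OF assms(2)]] by blast
  then show thesis
  proof cases
    case 1
    obtain P' Q' where "w = c P' Q'" "ac_eq E P P'" "ac_eq E Q Q'"
      using ac_eq_constr[OF ac_eq_sym[OF 1(2)] assms(2) goodD(1)[OF gd]] by blast
    with 1(1) show ?thesis
      using that(1) ac_eq_sym by blast
  next
    case 2
    then show ?thesis
      using that(2) constr_inject[OF assms(2)] by metis
  qed
qed

text \<open>Supplies the side premises of left rules: a key inside a saturated message has all its
  factors in \<open>factors\<close>, so \<open>known_right_derivable\<close> applies.\<close>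

lemma saturated_key:
  assumes "N \<in> saturated" and "subterm K' N" and "ac_eq E K' K" and "known K"
  shows "right_derivable E saturated K'"
proof (rule known_right_derivable[OF assms(4) _ assms(3)])
  show "good E K'"
    using good_subterm[OF assms(2) saturated_good[OF assms(1)]] .
  show "A \<in> factors" if "E_factor E A K'" for A
    using saturated_factor[OF assms(1)] E_factor_subterm[OF that assms(2)] by blast
qed

lemma known_MPair:
  assumes "known (MPair M N)"
  shows "known M \<and> known N"
  using assms constr_in_constrs(3)
proof (cases rule: known_constr_cases)
  case (1 M' N')
  then have "M' \<in> saturated" "N' \<in> saturated"
    using saturated_extension[OF extension.pair] by blast+
  then show ?thesis
    using 1 saturated_known_ac_eq good_constrD[OF constr_in_constrs(3) known_good[OF assms]] by blast
qed simp

lemma known_decrypt: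
  assumes "known (c M K)" and "c = Enc \<or> c = Blind" and "known K"
  shows "known M"
proof -
  have c: "c \<in> constrs"
    using assms(2) by auto
  show ?thesis
    using assms(1) c
  proof (cases rule: known_constr_cases)
    case (1 M' K')
    have "right_derivable E saturated K'"
      by (rule saturated_key[OF 1(1) _ 1(3) assms(3)])
        (use assms(2) in \<open>auto intro: immediate_subterm_subterm\<close>)
    then have "M' \<in> saturated"
      using saturated_extension[OF extension.enc] saturated_extension[OF extension.blind]
        1(1) assms(2) by blast
    then show ?thesis
      using 1(2) saturated_known_ac_eq good_constrD[OF c known_good[OF assms(1)]] by blast
  qed
qed

lemma known_Sign:
  assumes "known (Sign M K)" and "known (Pub L)" and "ac_eq E K L"
  shows "known M"
  using assms(1) constr_in_constrs(1)
proof (cases rule: known_constr_cases)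
  case (1 M' K')
  \<comment> \<open>No member of \<open>constrs\<close> builds \<open>Pub L\<close>, so only the
    saturated alternative remains.\<close>
  obtain w where w: "w \<in> saturated" "ac_eq E w (Pub L)"
    using known_alien[OF assms(2)] by (auto elim: constrsE)
  then obtain L' where L': "w = Pub L'" "ac_eq E L L'"
    using ac_eq_Pub[OF ac_eq_sym[OF w(2)]] by blast
  have "ac_eq E K' L'"
    using ac_eq_trans[OF ac_eq_trans[OF 1(3) assms(3)] L'(2)] .
  then have "M' \<in> saturated"
    using saturated_extension[OF extension.sign] 1(1) w(1) L'(1) by blast
  then show ?thesis
    using 1(2) saturated_known_ac_eq
      good_constrD[OF constr_in_constrs(1) known_good[OF assms(1)]] by blast
qed

lemma known_unblind:
  assumes "known (Sign (Blind M R) K)" and "known R"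
  shows "known (Sign M K)"
  using assms(1) constr_in_constrs(1)
proof (cases rule: known_constr_cases)
  case (1 B K')
  have gd: "good E (Blind M R)" "good E K"
    using good_constrD[OF constr_in_constrs(1) known_good[OF assms(1)]] by simp_all
  have gM: "good E M"
    using good_constrD[OF constr_in_constrs(2) gd(1)] by simp
  obtain M' R' where B: "B = Blind M' R'" "ac_eq E M M'" "ac_eq E R R'"
    using ac_eq_constr[OF ac_eq_sym[OF 1(2)] constr_in_constrs(2) goodD(1)[OF gd(1)]] by blast
  have "subterm R' B" "subterm B (Sign B K')"
    using B(1) by (simp_all add: immediate_subterm_subterm)
  then have "subterm R' (Sign B K')"
    by (rule subterm_trans)
  then have "right_derivable E saturated R'"
    using saturated_key[OF 1(1) _ ac_eq_sym[OF B(3)] assms(2)] by blast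
  then have "Sign M' K' \<in> saturated"
    using saturated_extension[OF extension.unblind] 1(1) B(1) by blast
  moreover have "ac_eq E (Sign M' K') (Sign M K)"
    using ac_eq_sym[OF ac_eq_constrI[OF _ B(2) ac_eq_sym[OF 1(3)]]] gM gd(2) goodD(1) by blast
  moreover have "good E (Sign M K)"
    using good_constr[OF constr_in_constrs(1)] gM gd(2) by blast
  ultimately show ?thesis
    by (rule saturated_known_ac_eq)
next
  \<comment> \<open>The signature is composed of known parts: its blinded body is opened with
    \<open>R\<close> and signed again with \<open>K\<close>.\<close>
  case 2
  then show ?thesis
    using known_constr[OF constr_in_constrs(1) _ 2(2)] known_decrypt[of Blind M R] 2(1) assms(2)
    by simp
qed

section \<open>Soundness of all rules, cut included, for known messages\<close>

lemma rule_inst_known: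
  assumes "rule_inst E \<rho> Ss S" and "sequent E S"
    and prems: "\<forall>(\<Delta>, N)\<in>set Ss. (\<forall>x\<in>\<Delta>. known x) \<longrightarrow> known N"
    and ante: "\<forall>x\<in>fst S. known x"
  shows "known (snd S)"
  using assms(1)
proof cases
  case (1 C Ms \<Gamma>' M)
  have "good E M"
    using assms(2) 1(3) by (simp add: sequent_def good_def)
  then show ?thesis
    using known_context[OF _ 1(7) sig_closure_fill[OF 1(4-6)]] ante 1(3) by simp
next
  case (3 M N \<Gamma>' U)
  then have "known M" "known N"
    using known_MPair[of M N] ante by simp_all
  then show ?thesis
    using 3 prems ante by simp
next
  case (5 M K \<Gamma>' U)
  then have K: "known K"
    using prems ante by simp
  then have "known M"
    using 5 known_decrypt[of Enc M K] ante by simp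
  with K show ?thesis
    using 5 prems ante by simp
next
  case (7 K L M \<Gamma>' U)
  then have "known M"
    using known_Sign[of M K L] ante by simp
  then show ?thesis
    using 7 prems ante by simp
next
  case (9 M K \<Gamma>' U)
  then have K: "known K"
    using prems ante by simp
  then have "known M"
    using 9 known_decrypt[of Blind M K] ante by simp
  with K show ?thesis
    using 9 prems ante by simp
next
  case (11 M R K \<Gamma>' U)
  then have R: "known R"
    using prems ante by simp
  then have "known (Sign M K)"
    using 11 known_unblind[of M R K] ante by simp
  with R show ?thesis
    using 11 prems ante by simp
\<comment> \<open>This leaves the right rules, \<open>Cut\<close> and \<open>ACut\<close>. For both
  cuts the first premise makes the added message known, and then the second applies.\<close>
qed (use prems ante in \<open>simp_all add: known_constr\<close>)

lemma derives_known: "derives E d S \<Longrightarrow> \<forall>x\<in>fst S. known x \<Longrightarrow> known (snd S)"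
proof (induction rule: derives.induct)
  case (1 S \<rho> Ss ds)
  have "(\<forall>x\<in>\<Delta>. known x) \<longrightarrow> known N" if mem: "(\<Delta>, N) \<in> set Ss" for \<Delta> N
  proof -
    obtain i where "i < length Ss" "Ss ! i = (\<Delta>, N)"
      using mem by (auto simp: in_set_conv_nth)
    then show ?thesis
      using list_all2_nthD2[OF 1(3), of i] by simp
  qed
  then show ?case
    using rule_inst_known[OF 1(2,1)] 1(4) by blast
qed

text \<open>The given derivation, cuts included, serves only to show \<open>known T\<close>. The
  factors of \<open>T\<close> lie in \<open>factors\<close> by definition, so
  \<open>known_right_derivable\<close> applies to \<open>T\<close> itself.\<close>

lemma cut_admissible:
  assumes "derives E d (\<Gamma>, T)"
  shows "cut_free E \<Gamma> T"
proof -
  have "\<Gamma> \<subseteq> saturated"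
    using reachable.start unfolding saturated_def by blast
  then have "known T"
    using derives_known[OF assms] saturated_known by (simp add: subset_iff)
  moreover have "A \<in> factors" if "E_factor E A T" for A
    using that by (auto simp: E_factor_of_set_def)
  ultimately have "right_derivable E saturated T"
    by (intro known_right_derivable[of T T]) (auto simp: good_sequent)
  then show ?thesis
    by (rule right_derivable_saturated_cut_free)
qed

end

theorem theorem3p12:
  fixes E :: "'f eq_theory" and \<Gamma> :: "'f msg set" and M :: "'f msg"
  assumes "ac_convergent_theory E"
    and "\<exists>d. derives E d (\<Gamma>, M)"
  shows "\<exists>d. derives E d (\<Gamma>, M) \<and> Cut \<notin> rules_used d"
proof -
  obtain d where d: "derives E d (\<Gamma>, M)"
    using assms(2) by blast
  then have "sequent E (\<Gamma>, M)"
    by cases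
  with assms(1) interpret saturation E \<Gamma> M
    by unfold_locales
  show ?thesis
    using cut_admissible[OF d] by (simp add: cut_free_def)
qed

end
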